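(* Let $N\geq2$, $1\leq d<N$ be integers, $0<p<q\leq\infty$ and $s>\sigma_p$. Let $\chi:=\frac{qp}{q-p}$ if $q<\infty$ and $\chi:=p$ if $q=\infty$. Let $\Psi$ be an admissible function such that $$\sum_{j\geq0}\Psi(2^{-j})^\chi=\infty.$$ If $q<\infty$ and $\Psi$ is increasing suppose, in addition, that $$\frac{qp}{q-p}<\frac{1}{c_\infty}\qquad\text{where}\quad c_\infty:=\sup_{0<t\leq1}\log_2\frac{\Psi(t)}{\Psi(t^2)}.$$ Then there is a function $f\in B_{p,q}^s(\mathbb{R}^N)$ such that $$f(\cdot,y)\notin B_{p,q}^{(s,\Psi)}(\mathbb{R}^d)\qquad\text{for a.e. } y\in\mathbb{R}^{N-d}.$$
   Context: $\sigma_p:=N\left(\frac1p-1\right)_+$ with $x_+=\max\{0,x\}$. Points of $\mathbb{R}^N$ are written $(x,y)$ with $x\in\mathbb{R}^d$, $y\in\mathbb{R}^{N-d}$, and $f(\cdot,y)$ is the function $x\mapsto f(x,y)$ on $\mathbb{R}^d$. Convention: $1/c_\infty=+\infty$ if $c_\infty=0$. A real function $\Psi$ on $(0,1]$ is called admissible if it is positive and monotone on $(0,1]$ and $\Psi(2^{-j})\sim\Psi(2^{-2j})$ for all $j\in\mathbb{N}=\{0,1,2,\dots\}$, i.e. there are constants $0<c\le C$ with $c\,\Psi(2^{-2j})\leq\Psi(2^{-j})\leq C\,\Psi(2^{-2j})$ for all $j$. For $M\in\{1,2,\dots\}$ and $h\in\mathbb{R}^n$, $\Delta_h^Mf(x)=\sum_{j=0}^M(-1)^{M-j}\binom{M}{j}f(x+hj)$.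 Let $n\geq1$, $0<p,q\leq\infty$, $s>n(\frac1p-1)_+$ with $s>0$, and let $M>s$ be an integer. The Besov space $B_{p,q}^s(\mathbb{R}^n)$ is the set of all $f\in L^p(\mathbb{R}^n)$ with $\left(\int_{|h|\leq1}\|\Delta_h^Mf\|_{L^p(\mathbb{R}^n)}^q\frac{\mathrm{d}h}{|h|^{n+sq}}\right)^{1/q}<\infty$ (for $q=\infty$: $\sup_{0<|h|\leq1}|h|^{-s}\|\Delta_h^Mf\|_{L^p(\mathbb{R}^n)}<\infty$). For $\Psi$ admissible, the Besov space of generalized smoothness $B_{p,q}^{(s,\Psi)}(\mathbb{R}^n)$ is the set of all $f\in L^p(\mathbb{R}^n)$ with $$\left(\int_0^1\sup_{|h|\leq t}\|\Delta_h^Mf\|_{L^p(\mathbb{R}^n)}^q\frac{\Psi(t)^q}{t^{1+sq}}\,\mathrm{d}t\right)^{1/q}<\infty$$ (for $q=\infty$: $\sup_{0<t\leq1}t^{-s}\Psi(t)\sup_{|h|\leq t}\|\Delta_h^Mf\|_{L^p(\mathbb{R}^n)}<\infty$). Different choices of $M>s$ give the same spaces. *)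

theory Defs
  imports "HOL-Analysis.Analysis" "HOL-Probability.Essential_Supremum"
begin

text \<open>
  Functions are real-valued and treated pointwise (not as classes modulo null sets); measurability,
  integrals and null sets refer to the complete Lebesgue measure. Quasi-norms take values in
  \<^typ>\<open>ennreal\<close>, and integrability exponents in \<open>(0, \<infinity>]\<close> are elements of \<^typ>\<open>ennreal\<close>.
\<close>

text \<open>\<open>x\<^sup>r\<close> for an extended \<open>x\<close>; only used with \<open>r > 0\<close>, hence \<open>\<infinity>\<^sup>r = \<infinity>\<close>.\<close>

definition epowr :: "ennreal \<Rightarrow> real \<Rightarrow> ennreal" where
  "epowr x r = (if x = \<infinity> then \<infinity> else ennreal (enn2real x powr r))"

definition Lp_norm :: "ennreal \<Rightarrow> ('a::euclidean_space \<Rightarrow> real) \<Rightarrow> ennreal" where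
  "Lp_norm p f =
     (if p = \<infinity> then esssup lebesgue (\<lambda>x. ennreal \<bar>f x\<bar>)
      else epowr (\<integral>\<^sup>+x. ennreal (\<bar>f x\<bar> powr enn2real p) \<partial>lebesgue) (1 / enn2real p))"

definition Lp_space :: "ennreal \<Rightarrow> ('a::euclidean_space \<Rightarrow> real) set" where
  "Lp_space p = {f. f \<in> borel_measurable lebesgue \<and> Lp_norm p f < \<infinity>}"

definition fin_diff :: "nat \<Rightarrow> 'a::euclidean_space \<Rightarrow> ('a \<Rightarrow> real) \<Rightarrow> 'a \<Rightarrow> real" where
  "fin_diff M h f x = (\<Sum>j\<le>M. (- 1) ^ (M - j) * real (M choose j) * f (x + real j *\<^sub>R h))"

text \<open>
  The order \<open>M\<close> of the differences is an explicit parameter of both spaces; the definitions are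
  meant for integers \<open>M > s\<close>. The integrand at \<open>h = 0\<close> is \<open>0\<close>, as \<open>1 / 0 = 0\<close>.
\<close>

definition besov_seminorm ::
  "nat \<Rightarrow> real \<Rightarrow> ennreal \<Rightarrow> ennreal \<Rightarrow> ('a::euclidean_space \<Rightarrow> real) \<Rightarrow> ennreal" where
  "besov_seminorm M s p q f =
     (if q = \<infinity>
      then (SUP h\<in>cball 0 1 - {0}. ennreal (norm h powr (- s)) * Lp_norm p (fin_diff M h f))
      else epowr
        (\<integral>\<^sup>+h\<in>cball 0 1. epowr (Lp_norm p (fin_diff M h f)) (enn2real q)
            * ennreal (1 / norm h powr (real DIM('a) + s * enn2real q)) \<partial>lebesgue)
        (1 / enn2real q))"

definition besov_space ::
  "nat \<Rightarrow> real \<Rightarrow> ennreal \<Rightarrow> ennreal \<Rightarrow> ('a::euclidean_space \<Rightarrow> real) set" where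
  "besov_space M s p q = {f \<in> Lp_space p. besov_seminorm M s p q f < \<infinity>}"

definition gen_besov_seminorm ::
  "nat \<Rightarrow> real \<Rightarrow> (real \<Rightarrow> real) \<Rightarrow> ennreal \<Rightarrow> ennreal \<Rightarrow> ('a::euclidean_space \<Rightarrow> real) \<Rightarrow> ennreal"
where
  "gen_besov_seminorm M s \<Psi> p q f =
     (if q = \<infinity>
      then (SUP t\<in>{0<..1}. ennreal (t powr (- s) * \<Psi> t)
              * (SUP h\<in>cball 0 t. Lp_norm p (fin_diff M h f)))
      else epowr
        (\<integral>\<^sup>+t\<in>{0<..1}. (SUP h\<in>cball 0 t. epowr (Lp_norm p (fin_diff M h f)) (enn2real q))
            * ennreal (\<Psi> t powr enn2real q / t powr (1 + s * enn2real q)) \<partial>lebesgue)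
        (1 / enn2real q))"

definition gen_besov_space ::
  "nat \<Rightarrow> real \<Rightarrow> (real \<Rightarrow> real) \<Rightarrow> ennreal \<Rightarrow> ennreal \<Rightarrow> ('a::euclidean_space \<Rightarrow> real) set"
where
  "gen_besov_space M s \<Psi> p q = {f \<in> Lp_space p. gen_besov_seminorm M s \<Psi> p q f < \<infinity>}"

definition admissible :: "(real \<Rightarrow> real) \<Rightarrow> bool" where
  "admissible \<Psi> \<longleftrightarrow>
     (\<forall>t\<in>{0<..1}. 0 < \<Psi> t) \<and>
     (mono_on {0<..1} \<Psi> \<or> antimono_on {0<..1} \<Psi>) \<and>
     (\<exists>c C. 0 < c \<and> c \<le> C \<and>
        (\<forall>j::nat. c * \<Psi> ((1/2) ^ (2 * j)) \<le> \<Psi> ((1/2) ^ j) \<and>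
                  \<Psi> ((1/2) ^ j) \<le> C * \<Psi> ((1/2) ^ (2 * j))))"

text \<open>
  Valued in \<^typ>\<open>ereal\<close>, where \<open>1 / 0 = \<infinity>\<close>; so \<open>1 / c_inf \<Psi>\<close> follows the
  convention that the reciprocal of a vanishing \<open>c_inf \<Psi>\<close> is infinite.
\<close>

definition c_inf :: "(real \<Rightarrow> real) \<Rightarrow> ereal" where
  "c_inf \<Psi> = (SUP t\<in>{0<..1}. ereal (log 2 (\<Psi> t / \<Psi> (t^2))))"

definition sigma_p :: "nat \<Rightarrow> real \<Rightarrow> real" where
  "sigma_p N p = real N * max 0 (1 / p - 1)"

definition chi :: "real \<Rightarrow> ennreal \<Rightarrow> real" where
  "chi p q = (if q = \<infinity> then p else enn2real q * p / (enn2real q - p))"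

end

theory Submission
  imports Defs
begin

text \<open>
  Why such a function exists. Write $a_j = \Psi(2^{-j})^p$. A smooth bump at scale $2^{-j}$ in
  $x$, normalised to be of size $2^{-js} \lambda_j$ in $L^p(dx)$, has differences of order $M$
  which are as large as $2^{-js} \lambda_j$ for one step of length $2^{-j}$, and it contributes
  $\lambda_j \Psi(2^{-j})$ to the generalised seminorm of a slice. Spread this bump over a box
  $E_j$ in the variable $y$: then its contribution to the isotropic seminorm is only
  $\lambda_j |E_j|^{1/p}$. So it suffices to find $\lambda_j$ and boxes $E_j$ such that
  $(\lambda_j |E_j|^{1/p})_j$ is in $\ell^q$, while every $y$ lies in infinitely many $E_j$ along
  which $\lambda_j \Psi(2^{-j}) \to \infty$.

  Covering every $y$ infinitely often is possible as soon as the side lengths $\rho_j$ of $E_j$ in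
  one fixed direction have a divergent sum: the centres follow an oscillating path of speed at most one
  (\<open>walk_visits_infinitely_often\<close>), and in all other directions $E_j$ has a side
  $L_j \to \infty$. With $m_j = \lambda_j^p |E_j|$ the requirements become $m \in \ell^{q/p}$ and
  $\sum_j a_j m_j / \omega_j = \infty$ for some $\omega_j \to \infty$. The hypothesis on $\Psi$ says
  that $(a_j)$ is not in the dual space $\ell^{(q/p)'}$, so such $m$ and $\omega$ exist by the
  Abel-Dini theorem (\<open>exists_weights\<close>). Then $\rho_j = a_j m_j / \omega_j$; indices with
  $\rho_j < 2^{-j}$ are dropped, which costs a convergent sum and guarantees that every bump is
  smooth at scale $2^{-j}$ in all directions.

  The bumps are placed in slabs orthogonal to one $x$-direction which are so far apart that a difference
  with step of length at most one never meets two of them. Hence the $p$-th powers of the $L^p$ norms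
  of the differences simply add up, for every $p > 0$, and the bumps cannot cancel in a slice. What
  remains is a discrete Hardy inequality for the upper bound (\<open>besov_space_dyadicI\<close>) and the
  lower bound by a single bump on a slice (\<open>Lp_norm_fin_diff_slice_ge\<close>).
\<close>

section \<open>Finite differences\<close>

lemma fin_diff_0 [simp]: "fin_diff 0 h f x = f x"
  by (simp add: fin_diff_def)

lemma fin_diff_Suc: "fin_diff (Suc k) h f x = fin_diff k h f (x + h) - fin_diff k h f x"
proof -
  define w where "w j = f (x + real j *\<^sub>R h)" for j
  have A: "fin_diff k h f (x + h) = (\<Sum>j\<le>k. (- 1) ^ (k - j) * real (k choose j) * w (Suc j))"
    by (simp add: fin_diff_def w_def algebra_simps)
  have "fin_diff k h f x = (\<Sum>j\<le>Suc k. (- 1) ^ (k - j) * real (k choose j) * w j)"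
    by (simp add: fin_diff_def w_def)
  also have "\<dots> = (- 1) ^ k * w 0 + (\<Sum>j\<le>k. (- 1) ^ (k - Suc j) * real (k choose Suc j) * w (Suc j))"
    by (subst sum.atMost_Suc_shift) simp
  also have "(\<Sum>j\<le>k. (- 1) ^ (k - Suc j) * real (k choose Suc j) * w (Suc j))
      = - (\<Sum>j\<le>k. (- 1) ^ (k - j) * real (k choose Suc j) * w (Suc j))"
    unfolding sum_negf [symmetric]
  proof (rule sum.cong)
    fix j assume "j \<in> {..k}"
    then consider "j = k" | "j < k" by fastforce
    then show "(- 1) ^ (k - Suc j) * real (k choose Suc j) * w (Suc j)
        = - ((- 1) ^ (k - j) * real (k choose Suc j) * w (Suc j))"
    proof cases
      case 2
      then have "k - j = Suc (k - Suc j)" by simp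
      then show ?thesis by simp
    qed simp
  qed simp
  finally have B: "fin_diff k h f x
      = (- 1) ^ k * w 0 - (\<Sum>j\<le>k. (- 1) ^ (k - j) * real (k choose Suc j) * w (Suc j))"
    by simp
  have "fin_diff (Suc k) h f x
      = - ((- 1) ^ k * w 0) + (\<Sum>j\<le>k. (- 1) ^ (k - j) * real (Suc k choose Suc j) * w (Suc j))"
    unfolding fin_diff_def w_def [symmetric] by (subst sum.atMost_Suc_shift) simp
  also have "\<dots> = - ((- 1) ^ k * w 0)
      + (\<Sum>j\<le>k. (- 1) ^ (k - j) * real (k choose j) * w (Suc j))
      + (\<Sum>j\<le>k. (- 1) ^ (k - j) * real (k choose Suc j) * w (Suc j))"
    by (simp add: algebra_simps sum.distrib)
  finally show ?thesis using A B by simp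
qed

lemma fin_diff_cong:
  "(\<And>k. k \<le> M \<Longrightarrow> f (x + real k *\<^sub>R h) = g (x' + real k *\<^sub>R h')) \<Longrightarrow>
    fin_diff M h f x = fin_diff M h' g x'"
  by (simp add: fin_diff_def)

lemma fin_diff_add: "fin_diff k h (\<lambda>x. f x + g x) x = fin_diff k h f x + fin_diff k h g x"
  by (simp add: fin_diff_def algebra_simps sum.distrib)

lemma fin_diff_cmult: "fin_diff k h (\<lambda>x. c * f x) x = c * fin_diff k h f x"
  by (simp add: fin_diff_def sum_distrib_left mult_ac)

lemma fin_diff_shift: "fin_diff k h (\<lambda>x. f (x + a)) x = fin_diff k h f (x + a)"
  by (rule fin_diff_cong) (simp add: add_ac)

lemma fin_diff_Suc': "fin_diff (Suc k) h f x = fin_diff k h (\<lambda>x. f (x + h) - f x) x"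
  using fin_diff_add [of k h "\<lambda>x. f (x + h)" "\<lambda>x. - 1 * f x" x]
  by (simp add: fin_diff_Suc fin_diff_shift fin_diff_cmult del: mult_minus1)
     (simp add: fin_diff_cmult [of k h "- 1" f x, simplified])

text \<open>
  One summand of $\Delta_h(fg) = (\Delta_h f)\, g(\cdot + h) + f\, \Delta_h g$ at a time: a bound
  $A t^i$ for the differences of order $i$ of $f$ turns into the bound $(A t) t^i$ for those of
  $\Delta_h f$, so that the induction works for all pairs $f$, $g$ at once and no Leibniz formula is
  needed. Both the step $h$ and the number $t$ that measures it are fixed.
\<close>

lemma fin_diff_bound_mult:
  fixes f g :: "'a::euclidean_space \<Rightarrow> real"
  assumes "\<And>i x. i \<le> k \<Longrightarrow> \<bar>fin_diff i h f x\<bar> \<le> A * t ^ i"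
    and "\<And>i x. i \<le> k \<Longrightarrow> \<bar>fin_diff i h g x\<bar> \<le> B * t ^ i"
    and "0 \<le> t"
  shows "\<bar>fin_diff k h (\<lambda>x. f x * g x) x\<bar> \<le> 2 ^ k * A * B * t ^ k"
  using assms(1,2)
proof (induction k arbitrary: f g A B x)
  case 0
  have "\<bar>f x\<bar> * \<bar>g x\<bar> \<le> A * B"
    using 0(1) [of 0 x] 0(2) [of 0 x] by (intro mult_mono) auto
  then show ?case by (simp add: abs_mult)
next
  case (Suc k)
  let ?f = "\<lambda>x. f (x + h) - f x" and ?g = "\<lambda>x. g (x + h) - g x"
  have 1: "\<bar>fin_diff k h (\<lambda>x. ?f x * g (x + h)) x\<bar> \<le> 2 ^ k * (A * t) * B * t ^ k"
  proof (rule Suc.IH)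
    show "\<bar>fin_diff i h ?f x\<bar> \<le> A * t * t ^ i" if "i \<le> k" for i x
      using Suc.prems(1) [of "Suc i" x] that by (simp add: fin_diff_Suc' mult.assoc)
    show "\<bar>fin_diff i h (\<lambda>x. g (x + h)) x\<bar> \<le> B * t ^ i" if "i \<le> k" for i x
      using Suc.prems(2) [of i "x + h"] that by (simp add: fin_diff_shift)
  qed
  have 2: "\<bar>fin_diff k h (\<lambda>x. f x * ?g x) x\<bar> \<le> 2 ^ k * A * (B * t) * t ^ k"
  proof (rule Suc.IH)
    show "\<bar>fin_diff i h ?g x\<bar> \<le> B * t * t ^ i" if "i \<le> k" for i x
      using Suc.prems(2) [of "Suc i" x] that by (simp add: fin_diff_Suc' mult.assoc)
    show "\<bar>fin_diff i h f x\<bar> \<le> A * t ^ i" if "i \<le> k" for i x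
      using Suc.prems(1) [of i x] that by simp
  qed
  have "fin_diff (Suc k) h (\<lambda>x. f x * g x) x
      = fin_diff k h (\<lambda>x. ?f x * g (x + h)) x + fin_diff k h (\<lambda>x. f x * ?g x) x"
    unfolding fin_diff_Suc' fin_diff_add [symmetric]
    by (rule fin_diff_cong) (simp add: algebra_simps)
  with 1 2 show ?case by (simp add: mult_ac)
qed

lemma fin_diff_bound_prod:
  fixes f :: "'b \<Rightarrow> 'a::euclidean_space \<Rightarrow> real"
  assumes "finite I" "0 \<le> t" "1 \<le> A"
    and "\<And>b i x. b \<in> I \<Longrightarrow> i \<le> k \<Longrightarrow> \<bar>fin_diff i h (f b) x\<bar> \<le> A * t ^ i"
  shows "i \<le> k \<Longrightarrow> \<bar>fin_diff i h (\<lambda>x. \<Prod>b\<in>I. f b x) x\<bar> \<le> (2 ^ k * A) ^ card I * t ^ i"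
  using assms(1,4)
proof (induction I arbitrary: i x rule: finite_induct)
  case empty
  have "\<bar>fin_diff i h (\<lambda>x. 1) x\<bar> \<le> t ^ i"
  proof (cases i)
    case (Suc k)
    have "fin_diff k h (\<lambda>x. 0) x = 0" by (simp add: fin_diff_def)
    then show ?thesis using \<open>0 \<le> t\<close> Suc by (simp only: fin_diff_Suc') simp
  qed simp
  then show ?case by simp
next
  case (insert b I)
  have "\<bar>fin_diff i h (\<lambda>x. f b x * (\<Prod>b\<in>I. f b x)) x\<bar>
      \<le> 2 ^ i * A * (2 ^ k * A) ^ card I * t ^ i"
    by (rule fin_diff_bound_mult) (use insert \<open>0 \<le> t\<close> in auto)
  also have "\<dots> \<le> 2 ^ k * A * (2 ^ k * A) ^ card I * t ^ i"
    using \<open>0 \<le> t\<close> \<open>1 \<le> A\<close> insert.prems(1) by (intro mult_right_mono power_increasing) auto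
  finally show ?case using insert by simp
qed

text \<open>
  The source of all lower bounds: once the steps leave the support, no cancellation is possible.
\<close>

lemma fin_diff_isolated:
  assumes "\<And>k. 1 \<le> k \<Longrightarrow> k \<le> M \<Longrightarrow> f (x + real k *\<^sub>R h) = 0"
  shows "\<bar>fin_diff M h f x\<bar> = \<bar>f x\<bar>"
proof -
  have "fin_diff M h f x = (\<Sum>j\<in>{0}. (- 1) ^ (M - j) * real (M choose j) * f (x + real j *\<^sub>R h))"
    unfolding fin_diff_def by (rule sum.mono_neutral_right) (use assms in auto)
  then show ?thesis by (simp add: abs_mult power_abs)
qed

lemma continuous_on_fin_diff:
  assumes "continuous_on UNIV f" shows "continuous_on UNIV (fin_diff i h f)"
proof -
  have "continuous_on UNIV (\<lambda>x. f (x + real j *\<^sub>R h))" for j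
    by (rule continuous_on_compose2 [OF assms]) (auto intro!: continuous_intros)
  then show ?thesis
    unfolding fin_diff_def [abs_def] by (intro continuous_on_sum continuous_on_mult_left)
qed

section \<open>Bumps\<close>

text \<open>
  The power $n$ controls the smoothness: the function has $n - 1$ continuous derivatives.
\<close>

definition bump :: "nat \<Rightarrow> real \<Rightarrow> real" where
  "bump n t = max 0 (1 - t\<^sup>2) ^ n"

lemma has_real_derivative_pos_part_power:
  "((\<lambda>t::real. max 0 t ^ Suc (Suc n)) has_real_derivative real (Suc (Suc n)) * max 0 t ^ Suc n) (at t)"
proof -
  consider "t < 0" | "t = 0" | "t > 0" by linarith
  then show ?thesis
  proof cases
    case 1
    have "((\<lambda>t::real. 0) has_real_derivative real (Suc (Suc n)) * max 0 t ^ Suc n) (at t)"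
      using 1 by (simp add: max_def)
    then show ?thesis
      by (rule has_field_derivative_transform_within_open [of _ _ _ "{..<0}"]) (use 1 in auto)
  next
    case 3
    have "((\<lambda>t::real. t ^ Suc (Suc n)) has_real_derivative real (Suc (Suc n)) * max 0 t ^ Suc n) (at t)"
      using 3 DERIV_pow [of "Suc (Suc n)" t] by (simp add: max_def)
    then show ?thesis
      by (rule has_field_derivative_transform_within_open [of _ _ _ "{0<..}"]) (use 3 in auto)
  next
    case 2
    have "(\<lambda>h. max 0 h ^ Suc (Suc n) / h) \<midarrow>0\<rightarrow> (0::real)"
    proof (rule Lim_transform_eventually)
      have "(\<lambda>h. max 0 h ^ Suc n) \<midarrow>0\<rightarrow> (max 0 0 ^ Suc n :: real)"
        by (intro tendsto_intros)
      then show "(\<lambda>h. max 0 h ^ Suc n) \<midarrow>0\<rightarrow> (0::real)" by simp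
      show "\<forall>\<^sub>F h::real in at 0. max 0 h ^ Suc n = max 0 h ^ Suc (Suc n) / h"
        by (rule eventually_at_topological [THEN iffD2]) (auto simp: max_def intro!: exI [of _ UNIV])
    qed
    then show ?thesis using 2 by (simp add: DERIV_def)
  qed
qed

lemma has_real_derivative_bump_Suc_Suc:
  "(bump (Suc (Suc n)) has_real_derivative - 2 * real (Suc (Suc n)) * t * bump (Suc n) t) (at t)"
proof -
  have "((\<lambda>t. 1 - t\<^sup>2) has_real_derivative - 2 * t) (at t)"
    by (auto intro!: derivative_eq_intros)
  from DERIV_chain2 [OF has_real_derivative_pos_part_power this]
  show ?thesis by (simp only: bump_def [abs_def] mult_ac)
qed

lemma bump_nonneg: "0 \<le> bump n t" and bump_le_1: "bump n t \<le> 1"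
  by (auto simp: bump_def max_def intro!: power_le_one)

lemma bump_eq_0: "1 \<le> \<bar>t\<bar> \<Longrightarrow> 0 < n \<Longrightarrow> bump n t = 0"
  using abs_le_square_iff [of 1 t] by (simp add: bump_def max_def)

lemma bump_ge: "\<bar>t\<bar> \<le> 1 / 2 \<Longrightarrow> (3 / 4) ^ n \<le> bump n t"
proof -
  assume "\<bar>t\<bar> \<le> 1 / 2"
  then have "t\<^sup>2 \<le> (1 / 2)\<^sup>2" by (intro abs_le_square_iff [THEN iffD1]) auto
  then show ?thesis unfolding bump_def by (intro power_mono) (auto simp: power2_eq_square)
qed

lemma continuous_on_bump: "continuous_on A (bump n)"
  unfolding bump_def [abs_def] by (intro continuous_intros)

text \<open>
  Functions of the form \<open>P * bump n\<close> are stable under differentiation at the price of one power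
  \<open>n\<close>, because the derivative of \<open>bump n\<close> is a polynomial times \<open>bump (n - 1)\<close>. As
  $\Delta_h^{k+1} u(x)$ is the increment over a step $h$ of $\Delta_h^k u$, whose derivative is
  $\Delta_h^k u'$, the mean value theorem gives the bound by induction.
\<close>

lemma fin_diff_poly_bump_bounded:
  "k < n \<Longrightarrow> \<exists>C\<ge>0. \<forall>h x. \<bar>fin_diff k h (\<lambda>t. poly P t * bump n t) x\<bar> \<le> C * \<bar>h\<bar> ^ k"
proof (induction k arbitrary: n P)
  case 0
  have "compact ((\<lambda>t. poly P t * bump n t) ` {-1..1})"
    by (intro compact_continuous_image continuous_intros continuous_on_bump) auto
  then obtain C where C: "\<And>t. t \<in> {-1..1} \<Longrightarrow> \<bar>poly P t * bump n t\<bar> \<le> C"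
    by (fastforce dest!: compact_imp_bounded simp: bounded_iff)
  have "\<bar>poly P t * bump n t\<bar> \<le> \<bar>C\<bar>" for t
    using C [of t] bump_eq_0 [of t n] 0 by (cases "\<bar>t\<bar> \<le> 1") fastforce+
  then show ?case by (auto intro!: exI [of _ "\<bar>C\<bar>"])
next
  case (Suc k)
  then obtain n' where n: "n = Suc (Suc n')" by (cases n; cases "n - 1") auto
  define u where "u t = poly P t * bump n t" for t
  \<comment> \<open>Chosen such that the derivative of \<open>P * bump n\<close> is \<open>Q * bump (n - 1)\<close>.\<close>
  define Q where "Q = pderiv P * [:1, 0, - 1:] + smult (- 2 * real n) (pCons 0 P)"
  define u' where "u' t = poly Q t * bump (Suc n') t" for t
  have "(u has_real_derivative u' t) (at t)" for t
  proof -
    have *: "poly (pderiv P) t * bump n t + (- 2 * real n * t * bump (Suc n') t) * poly P t = u' t"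
    proof (cases "\<bar>t\<bar> \<le> 1")
      case True
      then have eq: "bump n t = (1 - t\<^sup>2) * bump (Suc n') t"
        by (simp add: n bump_def max_def abs_square_le_1)
      show ?thesis unfolding u'_def Q_def eq by (simp add: algebra_simps power2_eq_square)
    next
      case False
      then show ?thesis by (simp add: u'_def bump_eq_0 n)
    qed
    show ?thesis
      using DERIV_mult [OF poly_DERIV [of P t] has_real_derivative_bump_Suc_Suc [of n' t, folded n]]
      by (simp only: u_def [abs_def] *)
  qed
  then have D: "((\<lambda>x. fin_diff k h u x) has_real_derivative fin_diff k h u' x) (at x)" for h x
    unfolding fin_diff_def by (intro DERIV_sum DERIV_cmult DERIV_shift [THEN iffD1])
  obtain C where C: "C \<ge> 0" "\<And>h x. \<bar>fin_diff k h u' x\<bar> \<le> C * \<bar>h\<bar> ^ k"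
    using Suc.IH [of "Suc n'" Q] Suc.prems n unfolding u'_def [abs_def] by auto
  have "\<bar>fin_diff (Suc k) h u x\<bar> \<le> C * \<bar>h\<bar> ^ Suc k" for h x
  proof -
    have "norm (fin_diff k h u (x + h) - fin_diff k h u x) \<le> (C * \<bar>h\<bar> ^ k) * norm (x + h - x)"
      by (rule field_differentiable_bound [where S = UNIV]) (use D C in auto)
    then show ?thesis by (simp add: fin_diff_Suc mult_ac)
  qed
  then show ?case using C(1) unfolding u_def [abs_def] by blast
qed

lemma fin_diff_bump_bounded:
  "\<exists>C\<ge>1. \<forall>i\<le>k. \<forall>h x. \<bar>fin_diff i h (bump (Suc k)) x\<bar> \<le> C * \<bar>h\<bar> ^ i"
proof -
  have "\<exists>C\<ge>0. \<forall>h x. \<bar>fin_diff i h (bump (Suc k)) x\<bar> \<le> C * \<bar>h\<bar> ^ i" if "i \<le> k" for i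
    using fin_diff_poly_bump_bounded [of i "Suc k" 1] that by simp
  then obtain C where C: "\<And>i. i \<le> k \<Longrightarrow> C i \<ge> 0"
     "\<And>i h x. i \<le> k \<Longrightarrow> \<bar>fin_diff i h (bump (Suc k)) x\<bar> \<le> C i * \<bar>h\<bar> ^ i"
    by metis
  have "\<bar>fin_diff i h (bump (Suc k)) x\<bar> \<le> (1 + (\<Sum>i\<le>k. C i)) * \<bar>h\<bar> ^ i" if "i \<le> k" for i h x
  proof -
    have "C i \<le> (\<Sum>i\<le>k. C i)" using C(1) that by (intro member_le_sum) auto
    then have "C i * \<bar>h\<bar> ^ i \<le> (1 + (\<Sum>i\<le>k. C i)) * \<bar>h\<bar> ^ i" by (intro mult_right_mono) auto
    with C(2) [OF that, of h x] show ?thesis by linarith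
  qed
  moreover have "(\<Sum>i\<le>k. C i) \<ge> 0" by (intro sum_nonneg) (use C(1) in auto)
  ultimately show ?thesis by (intro exI [of _ "1 + (\<Sum>i\<le>k. C i)"]) auto
qed

text \<open>
  The vector \<open>r\<close> contains the half side lengths of the supporting box with centre \<open>c\<close>.
\<close>

definition box_bump :: "nat \<Rightarrow> 'a \<Rightarrow> 'a \<Rightarrow> 'a::euclidean_space \<Rightarrow> real" where
  "box_bump n c r z = (\<Prod>b\<in>Basis. bump n ((z - c) \<bullet> b / (r \<bullet> b)))"

lemma box_bump_nonneg: "0 \<le> box_bump n c r z" and box_bump_le_1: "box_bump n c r z \<le> 1"
  by (auto simp: box_bump_def bump_nonneg bump_le_1 intro!: prod_nonneg prod_le_1)

lemma continuous_on_box_bump: "continuous_on A (box_bump n c r)"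
  unfolding box_bump_def [abs_def]
  by (intro continuous_on_prod continuous_on_compose2 [OF continuous_on_bump [of UNIV]])
     (auto intro!: continuous_intros simp: divide_inverse)

lemma box_bump_eq_0:
  assumes "b \<in> Basis" "0 < r \<bullet> b" "r \<bullet> b \<le> \<bar>(z - c) \<bullet> b\<bar>" "0 < n"
  shows "box_bump n c r z = 0"
  unfolding box_bump_def
  by (rule prod_zero) (use assms bump_eq_0 in \<open>auto intro!: bexI [of _ b]\<close>)

lemma box_bump_ge:
  fixes z c r :: "'a::euclidean_space"
  assumes "\<And>b. b \<in> Basis \<Longrightarrow> 0 < r \<bullet> b \<and> \<bar>(z - c) \<bullet> b\<bar> \<le> r \<bullet> b / 2"
  shows "((3 / 4) ^ n) ^ DIM('a) \<le> box_bump n c r z"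
proof -
  have "(\<Prod>b\<in>(Basis :: 'a set). (3 / 4) ^ n) \<le> box_bump n c r z"
    unfolding box_bump_def
  proof (rule prod_mono)
    fix b :: 'a assume "b \<in> Basis"
    then have "\<bar>(z - c) \<bullet> b / (r \<bullet> b)\<bar> \<le> 1 / 2"
      using assms [of b] by (simp add: abs_divide field_simps)
    then show "0 \<le> (3 / 4 :: real) ^ n \<and> (3 / 4) ^ n \<le> bump n ((z - c) \<bullet> b / (r \<bullet> b))"
      using bump_ge by simp
  qed
  then show ?thesis by simp
qed

text \<open>
  Only the smallest side of the box limits the smoothness; long sides do no harm. The constant
  depends neither on the box nor on \<open>\<delta>\<close>, since the rescaled bump has the same differences as
  the standard one for a rescaled step.
\<close>

lemma fin_diff_box_bump_bounded:
  "\<exists>C\<ge>1. \<forall>(c::'a::euclidean_space) r h z \<delta> i. 0 < \<delta> \<longrightarrow> (\<forall>b\<in>Basis. \<delta> \<le> r \<bullet> b) \<longrightarrow> i \<le> M \<longrightarrow>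
     \<bar>fin_diff i h (box_bump (Suc M) c r) z\<bar> \<le> C * min 1 (norm h / \<delta>) ^ i"
proof -
  obtain C where C: "C \<ge> 1" "\<And>i h x. i \<le> M \<Longrightarrow> \<bar>fin_diff i h (bump (Suc M)) x\<bar> \<le> C * \<bar>h\<bar> ^ i"
    using fin_diff_bump_bounded [of M] by blast
  define K where "K = max (2 ^ M) ((2 ^ M * C) ^ DIM('a))"
  have "\<bar>fin_diff i h (box_bump (Suc M) c r) z\<bar> \<le> K * min 1 (norm h / \<delta>) ^ i"
    if "0 < \<delta>" and r: "\<forall>b\<in>Basis. \<delta> \<le> r \<bullet> b" and "i \<le> M" for c r h z :: 'a and \<delta> i
  proof -
    have "\<bar>fin_diff i h (\<lambda>z. bump (Suc M) ((z - c) \<bullet> b / (r \<bullet> b))) z\<bar> \<le> C * (norm h / \<delta>) ^ i"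
      if "b \<in> Basis" "i \<le> M" for b i z
    proof -
      have "fin_diff i h (\<lambda>z. bump (Suc M) ((z - c) \<bullet> b / (r \<bullet> b))) z
          = fin_diff i (h \<bullet> b / (r \<bullet> b)) (bump (Suc M)) ((z - c) \<bullet> b / (r \<bullet> b))"
        by (rule fin_diff_cong) (simp add: algebra_simps add_divide_distrib diff_divide_distrib)
      then have "\<bar>fin_diff i h (\<lambda>z. bump (Suc M) ((z - c) \<bullet> b / (r \<bullet> b))) z\<bar>
          \<le> C * \<bar>h \<bullet> b / (r \<bullet> b)\<bar> ^ i"
        using C(2) [OF that(2)] by (simp only:)
      also have "\<dots> \<le> C * (norm h / \<delta>) ^ i"
      proof -
        have "\<bar>h \<bullet> b / (r \<bullet> b)\<bar> \<le> norm h / \<delta>"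
          using r that(1) \<open>0 < \<delta>\<close> Basis_le_norm [OF that(1), of h]
          by (simp add: abs_divide) (intro frac_le, auto)
        then show ?thesis using C(1) by (intro mult_left_mono power_mono) auto
      qed
      finally show ?thesis .
    qed
    then have "\<bar>fin_diff i h (\<lambda>z. \<Prod>b\<in>Basis. bump (Suc M) ((z - c) \<bullet> b / (r \<bullet> b))) z\<bar>
        \<le> (2 ^ M * C) ^ DIM('a) * (norm h / \<delta>) ^ i"
      by (intro fin_diff_bound_prod [OF _ _ _ _ \<open>i \<le> M\<close>]) (use C(1) \<open>0 < \<delta>\<close> in auto)
    also have "\<dots> \<le> K * (norm h / \<delta>) ^ i"
      using \<open>0 < \<delta>\<close> by (intro mult_right_mono) (auto simp: K_def)
    finally have 1: "\<bar>fin_diff i h (box_bump (Suc M) c r) z\<bar> \<le> K * (norm h / \<delta>) ^ i"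
      by (simp add: box_bump_def [abs_def])
    have "\<bar>fin_diff i h (box_bump (Suc M) c r) z\<bar> \<le> (\<Sum>j\<le>i. real (i choose j))"
      unfolding fin_diff_def
      by (intro order_trans [OF sum_abs] sum_mono)
         (auto simp: abs_mult power_abs abs_of_nonneg [OF box_bump_nonneg] box_bump_le_1 intro!: mult_left_le)
    also have "\<dots> = 2 ^ i" using choose_row_sum [of i]
      by (metis of_nat_sum of_nat_power of_nat_numeral)
    also have "\<dots> \<le> 2 ^ M" using \<open>i \<le> M\<close> by (intro power_increasing) auto
    also have "\<dots> \<le> K" by (simp add: K_def)
    finally show ?thesis using 1 by (auto simp: min_def)
  qed
  moreover have "1 \<le> K" by (simp add: K_def le_max_iff_disj)
  ultimately show ?thesis by blast
qed

text \<open>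
  Besides the pointwise bound this only uses that the difference vanishes off $M + 1$ translates of
  the supporting box.
\<close>

lemma nn_integral_fin_diff_box_bump_le:
  assumes "0 < p"
  obtains C where "0 < C" and "\<And>(c::'a::euclidean_space) r h \<delta> i. 0 < \<delta> \<Longrightarrow> (\<And>b. b \<in> Basis \<Longrightarrow> \<delta> \<le> r \<bullet> b) \<Longrightarrow> i \<le> M \<Longrightarrow>
     (\<integral>\<^sup>+z. ennreal (\<bar>fin_diff i h (box_bump (Suc M) c r) z\<bar> powr p) \<partial>lborel)
     \<le> ennreal (C * (min 1 (norm h / \<delta>) ^ i) powr p * (\<Prod>b\<in>Basis. r \<bullet> b))"
proof -
  obtain K where K: "K \<ge> 1" "\<And>c r h z \<delta> i. 0 < \<delta> \<Longrightarrow> \<forall>b\<in>Basis. \<delta> \<le> r \<bullet> b \<Longrightarrow> i \<le> M \<Longrightarrow>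
     \<bar>fin_diff i h (box_bump (Suc M) c r) (z::'a)\<bar> \<le> K * min 1 (norm h / \<delta>) ^ i"
    using fin_diff_box_bump_bounded [of M, where 'a = 'a] by blast
  define C where "C = real (Suc M) * K powr p * 2 ^ DIM('a)"
  have "(\<integral>\<^sup>+z. ennreal (\<bar>fin_diff i h (box_bump (Suc M) c r) z\<bar> powr p) \<partial>lborel)
     \<le> ennreal (C * (min 1 (norm h / \<delta>) ^ i) powr p * (\<Prod>b\<in>Basis. r \<bullet> b))"
    if \<delta>: "0 < \<delta>" and r: "\<And>b. b \<in> Basis \<Longrightarrow> \<delta> \<le> r \<bullet> b" and "i \<le> M" for c r h :: 'a and \<delta> i
  proof -
    define D where "D = (K * min 1 (norm h / \<delta>) ^ i) powr p"
    let ?B = "\<lambda>k. cbox (c - r - real k *\<^sub>R h) (c + r - real k *\<^sub>R h)"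
    have rpos: "0 < r \<bullet> b" if "b \<in> Basis" for b using r [OF that] \<delta> by simp
    have pointwise: "ennreal (\<bar>fin_diff i h (box_bump (Suc M) c r) z\<bar> powr p)
        \<le> (\<Sum>k\<le>M. ennreal D * indicator (?B k) z)" for z
    proof (cases "\<exists>k\<le>i. z \<in> ?B k")
      case True
      then obtain k where k: "k \<le> i" "z \<in> ?B k" by blast
      have "ennreal (\<bar>fin_diff i h (box_bump (Suc M) c r) z\<bar> powr p) \<le> ennreal D"
        unfolding D_def using K \<delta> r \<open>0 < p\<close> \<open>i \<le> M\<close> by (intro ennreal_leI powr_mono2) auto
      also have "\<dots> = ennreal D * indicator (?B k) z" using k(2) by simp
      also have "\<dots> \<le> (\<Sum>k\<le>M. ennreal D * indicator (?B k) z)"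
        using k(1) \<open>i \<le> M\<close> by (intro member_le_sum) auto
      finally show ?thesis .
    next
      case False
      have "box_bump (Suc M) c r (z + real k *\<^sub>R h) = 0" if "k \<le> i" for k
      proof -
        have "z \<notin> ?B k" using False that by blast
        then obtain b where b: "b \<in> Basis"
          "\<not> ((c - r - real k *\<^sub>R h) \<bullet> b \<le> z \<bullet> b \<and> z \<bullet> b \<le> (c + r - real k *\<^sub>R h) \<bullet> b)"
          unfolding mem_box by blast
        have "r \<bullet> b \<le> \<bar>(z + real k *\<^sub>R h - c) \<bullet> b\<bar>"
          using b(2) unfolding inner_diff_left inner_add_left by linarith
        then show ?thesis by (rule box_bump_eq_0 [OF b(1) rpos [OF b(1)]]) simp
      qed
      then have "fin_diff i h (box_bump (Suc M) c r) z = 0" by (simp add: fin_diff_def)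
      then show ?thesis using \<open>0 < p\<close> by simp
    qed
    have "(\<integral>\<^sup>+z. ennreal (\<bar>fin_diff i h (box_bump (Suc M) c r) z\<bar> powr p) \<partial>lborel)
        \<le> (\<integral>\<^sup>+z. (\<Sum>k\<le>M. ennreal D * indicator (?B k) z) \<partial>lborel)"
      by (intro nn_integral_mono pointwise)
    also have "\<dots> = (\<Sum>k\<le>M. \<integral>\<^sup>+z. ennreal D * indicator (?B k) z \<partial>lborel)"
      by (intro nn_integral_sum borel_measurable_times_ennreal borel_measurable_const borel_measurable_indicator) simp
    also have "\<dots> = (\<Sum>k\<le>M. ennreal D * emeasure lborel (?B k))"
      by (intro sum.cong refl nn_integral_cmult_indicator) simp
    also have "\<dots> = (\<Sum>k\<le>M. ennreal (D * (2 ^ DIM('a) * (\<Prod>b\<in>Basis. r \<bullet> b))))"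
    proof (rule sum.cong [OF refl])
      fix k
      have "emeasure lborel (?B k) = ennreal (\<Prod>b\<in>Basis. (c + r - real k *\<^sub>R h - (c - r - real k *\<^sub>R h)) \<bullet> b)"
      proof (rule emeasure_lborel_cbox)
        fix b :: 'a assume "b \<in> Basis"
        then show "(c - r - real k *\<^sub>R h) \<bullet> b \<le> (c + r - real k *\<^sub>R h) \<bullet> b"
          using rpos [of b] by (simp add: inner_diff_left inner_add_left)
      qed
      also have "(\<Prod>b\<in>Basis. (c + r - real k *\<^sub>R h - (c - r - real k *\<^sub>R h)) \<bullet> b) = (\<Prod>b\<in>Basis. 2 * (r \<bullet> b))"
        by (rule prod.cong) (simp_all add: inner_diff_left inner_add_left)
      also have "\<dots> = 2 ^ DIM('a) * (\<Prod>b\<in>Basis. r \<bullet> b)" by (simp add: prod.distrib)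
      finally have "emeasure lborel (?B k) = ennreal (2 ^ DIM('a) * (\<Prod>b\<in>Basis. r \<bullet> b))" .
      then show "ennreal D * emeasure lborel (?B k) = ennreal (D * (2 ^ DIM('a) * (\<Prod>b\<in>Basis. r \<bullet> b)))"
        by (simp add: D_def ennreal_mult')
    qed
    also have "\<dots> = ennreal (\<Sum>k\<le>M. D * (2 ^ DIM('a) * (\<Prod>b\<in>Basis. r \<bullet> b)))"
      using rpos by (intro sum_ennreal mult_nonneg_nonneg prod_nonneg) (auto simp: D_def less_imp_le)
    also have "(\<Sum>k\<le>M. D * (2 ^ DIM('a) * (\<Prod>b\<in>Basis. r \<bullet> b)))
        = C * (min 1 (norm h / \<delta>) ^ i) powr p * (\<Prod>b\<in>Basis. r \<bullet> b)"
      by (simp add: C_def D_def powr_mult)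
    finally show ?thesis .
  qed
  moreover have "0 < C" using K(1) by (simp add: C_def)
  ultimately show thesis by (rule that [rotated])
qed

section \<open>Divergent series and dual sequences\<close>

text \<open>
  Half of the Abel-Dini theorem. Here and below the partial sums are increased by $1$ to keep them away
  from zero.
\<close>

lemma not_summable_divide_partial_sums:
  fixes e :: "nat \<Rightarrow> real"
  assumes e: "\<And>j. 0 \<le> e j" and div: "\<not> summable e"
  shows "\<not> summable (\<lambda>j. e j / (1 + (\<Sum>i\<le>j. e i)))"
proof
  let ?E = "\<lambda>j. 1 + (\<Sum>i\<le>j. e i)"
  have E1: "1 \<le> ?E j" for j using e by (simp add: sum_nonneg)
  assume "summable (\<lambda>j. e j / ?E j)"
  then obtain K where K: "\<And>m n. m \<ge> K \<Longrightarrow> norm (\<Sum>j=m..<n. e j / ?E j) < 1 / 2"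
    unfolding summable_Cauchy by (meson half_gt_zero zero_less_one)
  have "(\<Sum>j<n. e j) \<le> 2 * ?E K" for n
  proof (cases "n \<le> Suc K")
    case True
    then have "(\<Sum>j<n. e j) \<le> (\<Sum>i\<le>K. e i)" using e by (intro sum_mono2) auto
    moreover have "0 \<le> (\<Sum>i\<le>K. e i)" using e by (simp add: sum_nonneg)
    ultimately show ?thesis by (simp only: distrib_left)
  next
    case False
    then obtain n' where n: "n = Suc n'" "n' > K" by (cases n) auto
    let ?T = "\<Sum>j=Suc K..<n. e j"
    \<comment> \<open>A tail of the quotients is at least the share of $E_{n'}$ which was added after $K$; a
        convergent series would force all these shares to be at most one half.\<close>
    have "?T / ?E n' = (\<Sum>j=Suc K..<n. e j / ?E n')" by (simp add: sum_divide_distrib)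
    also have "\<dots> \<le> (\<Sum>j=Suc K..<n. e j / ?E j)"
    proof (rule sum_mono)
      fix j assume "j \<in> {Suc K..<n}"
      then have "?E j \<le> ?E n'" using e n by (auto intro!: sum_mono2)
      then show "e j / ?E n' \<le> e j / ?E j" using e E1 [of j] by (intro divide_left_mono) auto
    qed
    also have "\<dots> < 1 / 2" using K [of "Suc K" n] by (simp del: sum.op_ivl_Suc)
    finally have "?T < ?E n' / 2" using E1 [of n'] by (simp add: field_simps)
    moreover have "(\<Sum>j<n. e j) = (\<Sum>i\<le>K. e i) + ?T"
      using n sum.atLeastLessThan_concat [of 0 "Suc K" n e]
      by (simp only: lessThan_Suc_atMost [symmetric] atLeast0LessThan)
    moreover have "(\<Sum>j<n. e j) = ?E n' - 1" using n by (simp add: lessThan_Suc_atMost)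
    ultimately show ?thesis by simp
  qed
  then have "summable e"
    by (intro bounded_imp_summable [where B = "2 * ?E K"] e) (simp only: lessThan_Suc_atMost [symmetric])
  with div show False by simp
qed

text \<open>
  The other half of the Abel-Dini theorem, by comparison with the telescoping increments of
  $x \mapsto x^{1 - \beta}$ along the partial sums.
\<close>

lemma summable_divide_partial_sums_powr:
  fixes e :: "nat \<Rightarrow> real"
  assumes e: "\<And>j. 0 \<le> e j" and "\<beta> > 1"
  shows "summable (\<lambda>j. e j * (1 + (\<Sum>i\<le>j. e i)) powr (- \<beta>))"
proof -
  let ?E = "\<lambda>j. 1 + (\<Sum>i\<le>j. e i)"
  let ?g = "\<lambda>x::real. x powr (1 - \<beta>)"
  have E1: "1 \<le> ?E j" for j using e by (simp add: sum_nonneg)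
  have step: "(\<beta> - 1) * (e (Suc j) * ?E (Suc j) powr (- \<beta>)) \<le> ?g (?E j) - ?g (?E (Suc j))" for j
  proof (cases "e (Suc j) = 0")
    case False
    with e [of "Suc j"] have less: "?E j < ?E (Suc j)" by simp
    have D: "(?g has_real_derivative (1 - \<beta>) * x powr (- \<beta>)) (at x)" if "?E j \<le> x" for x
      using that E1 [of j] has_real_derivative_powr [of x "1 - \<beta>"] by simp
    obtain x where x: "?E j < x" "x < ?E (Suc j)"
      "?g (?E (Suc j)) - ?g (?E j) = (?E (Suc j) - ?E j) * ((1 - \<beta>) * x powr (- \<beta>))"
      using MVT2 [of "?E j" "?E (Suc j)" ?g "\<lambda>x. (1 - \<beta>) * x powr (- \<beta>)"] less D by auto
    then have eq: "?g (?E j) - ?g (?E (Suc j)) = (\<beta> - 1) * (e (Suc j) * x powr (- \<beta>))"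
      by (simp add: algebra_simps)
    have "?E (Suc j) powr (- \<beta>) \<le> x powr (- \<beta>)"
      using x E1 [of j] \<open>\<beta> > 1\<close> by (intro powr_mono2') auto
    then show ?thesis unfolding eq using e [of "Suc j"] \<open>\<beta> > 1\<close> by (intro mult_left_mono) auto
  qed simp
  have "(\<Sum>j\<le>n. e (Suc j) * ?E (Suc j) powr (- \<beta>)) \<le> ?g (?E 0) / (\<beta> - 1)" for n
  proof -
    have "(\<beta> - 1) * (\<Sum>j\<le>n. e (Suc j) * ?E (Suc j) powr (- \<beta>)) \<le> (\<Sum>j\<le>n. ?g (?E j) - ?g (?E (Suc j)))"
      unfolding sum_distrib_left by (intro sum_mono step)
    also have "\<dots> = ?g (?E 0) - ?g (?E (Suc n))" by (rule sum_telescope)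
    also have "\<dots> \<le> ?g (?E 0)" by simp
    finally show ?thesis using \<open>\<beta> > 1\<close> by (simp add: field_simps)
  qed
  then have "summable (\<lambda>j. e (Suc j) * ?E (Suc j) powr (- \<beta>))"
    by (intro bounded_imp_summable) (use e in auto)
  then show ?thesis by (subst summable_Suc_iff [symmetric]) simp
qed

lemma filterlim_partial_sums_at_top:
  fixes e :: "nat \<Rightarrow> real"
  assumes e: "\<And>j. 0 \<le> e j" and div: "\<not> summable e"
  shows "filterlim (\<lambda>n. \<Sum>i<n. e i) at_top sequentially"
proof (rule ccontr)
  assume "\<not> ?thesis"
  then obtain Z where Z: "\<not> (\<forall>\<^sub>F n in sequentially. Z \<le> (\<Sum>i<n. e i))"
    unfolding filterlim_at_top by blast
  have "(\<Sum>i<n. e i) \<le> Z" for n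
  proof -
    from Z obtain k where "n \<le> k" "\<not> Z \<le> (\<Sum>i<k. e i)"
      unfolding eventually_sequentially by blast
    moreover have "(\<Sum>i<n. e i) \<le> (\<Sum>i<k. e i)"
      using \<open>n \<le> k\<close> e by (intro sum_mono2) auto
    ultimately show ?thesis by linarith
  qed
  then have "summable e"
    by (intro bounded_imp_summable [where B = Z] e) (simp only: lessThan_Suc_atMost [symmetric])
  with div show False by simp
qed

text \<open>
  The quantitative form of the duality between $\ell^r$ and $\ell^{r'}$: a sequence that is not in
  $\ell^{r'}$ has a divergent pairing with some \<open>m\<close> in $\ell^r$, and this survives the division by
  a sequence \<open>\<omega>\<close> that tends to infinity.
\<close>

lemma exists_dual_sequence_powr:
  fixes a :: "nat \<Rightarrow> real"
  assumes a: "\<And>j. 0 < a j" and "1 < r" and div: "\<not> summable (\<lambda>j. a j powr (r / (r - 1)))"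
  shows "\<exists>m \<omega>. (\<forall>j. 0 \<le> m j) \<and> (\<forall>j. 1 \<le> \<omega> j) \<and> filterlim \<omega> at_top sequentially
     \<and> summable (\<lambda>j. m j powr r) \<and> \<not> summable (\<lambda>j. a j * m j / \<omega> j)"
proof -
  define e where "e j = a j powr (r / (r - 1))" for j
  define E where "E j = 1 + (\<Sum>i\<le>j. e i)" for j
  \<comment> \<open>With $E$ the partial sums of $e = a^{r'}$, the choice below gives $a m / \omega = e / E$ and
      $m^r = e E^{- \alpha r}$. Any $\alpha$ strictly between $1/r$ and $1$ serves: the first series
      diverges, the second one converges, and $\omega$ is a positive power of $E$.\<close>
  define \<alpha> where "\<alpha> = (1 + 1 / r) / 2"
  have \<alpha>: "1 < \<alpha> * r" "\<alpha> < 1" using \<open>1 < r\<close> by (auto simp: \<alpha>_def field_simps)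
  have e: "0 \<le> e j" for j by (simp add: e_def)
  have E1: "1 \<le> E j" for j using e by (simp add: E_def sum_nonneg)
  define m where "m j = a j powr (1 / (r - 1)) * E j powr (- \<alpha>)" for j
  define \<omega> where "\<omega> j = E j powr (1 - \<alpha>)" for j
  have lim: "filterlim E at_top sequentially"
  proof -
    have "filterlim (\<lambda>n. \<Sum>i<Suc n. e i) at_top sequentially"
      using filterlim_partial_sums_at_top [OF e] div
      by (subst filterlim_sequentially_Suc) (simp only: e_def [abs_def])
    then show ?thesis
      by (rule filterlim_at_top_mono) (simp add: E_def lessThan_Suc_atMost)
  qed
  have "m j powr r = e j * E j powr (- (\<alpha> * r))" for j
    using \<open>1 < r\<close> by (simp add: m_def e_def powr_mult powr_powr)
  then have s: "summable (\<lambda>j. m j powr r)"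
    using summable_divide_partial_sums_powr [of e "\<alpha> * r"] e \<alpha> by (simp add: E_def)
  have "a j * m j / \<omega> j = e j / E j" for j
  proof -
    have "a j * a j powr (1 / (r - 1)) = e j"
      using a [of j] \<open>1 < r\<close> powr_add [of "a j" 1 "1 / (r - 1)"] by (simp add: e_def field_simps)
    moreover have "E j powr (- \<alpha>) / E j powr (1 - \<alpha>) = 1 / E j"
      using E1 [of j] powr_diff [of "E j" "- \<alpha>" "1 - \<alpha>"] by (simp add: powr_minus_divide)
    moreover have "a j * m j / \<omega> j = (a j * a j powr (1 / (r - 1))) * (E j powr (- \<alpha>) / E j powr (1 - \<alpha>))"
      by (simp add: m_def \<omega>_def)
    ultimately show ?thesis by simp
  qed
  then have ns: "\<not> summable (\<lambda>j. a j * m j / \<omega> j)"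
    using not_summable_divide_partial_sums [OF e] div by (simp add: E_def e_def [abs_def])
  have "filterlim \<omega> at_top sequentially"
    unfolding \<omega>_def by (rule filterlim_compose [OF real_powr_at_top lim]) (use \<alpha> in simp)
  moreover have "1 \<le> \<omega> j" for j using E1 \<alpha> by (simp add: \<omega>_def ge_one_powr_ge_zero)
  moreover have "0 \<le> m j" for j by (simp add: m_def)
  ultimately show ?thesis using s ns by blast
qed

text \<open>
  The limiting case $r = \infty$ with \<open>m\<close> constant.
\<close>

lemma exists_dual_sequence_bounded:
  fixes a :: "nat \<Rightarrow> real"
  assumes a: "\<And>j. 0 < a j" and div: "\<not> summable a"
  shows "\<exists>\<omega>. (\<forall>j. 1 \<le> \<omega> j) \<and> filterlim \<omega> at_top sequentially \<and> \<not> summable (\<lambda>j. a j / \<omega> j)"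
proof (intro exI conjI allI)
  define E where "E j = 1 + (\<Sum>i\<le>j. a i)" for j
  have a0: "0 \<le> a j" for j using a [of j] by simp
  show "\<not> summable (\<lambda>j. a j / E j)"
    using not_summable_divide_partial_sums [OF a0 div] by (simp add: E_def)
  show "1 \<le> E j" for j using a0 by (simp add: E_def sum_nonneg)
  have "filterlim (\<lambda>n. \<Sum>i<Suc n. a i) at_top sequentially"
    using filterlim_partial_sums_at_top [OF a0 div] by (subst filterlim_sequentially_Suc)
  then show "filterlim E at_top sequentially"
    by (rule filterlim_at_top_mono) (simp add: E_def lessThan_Suc_atMost)
qed

text \<open>
  Terms below $2^{-j}$ contribute a convergent sum only.
\<close>

lemma not_summable_truncate:
  fixes \<tau> :: "nat \<Rightarrow> real"
  assumes "\<And>j. 0 \<le> \<tau> j" "\<not> summable \<tau>"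
  shows "\<not> summable (\<lambda>j. if (1/2) ^ j \<le> \<tau> j then \<tau> j else 0)"
proof
  assume "summable (\<lambda>j. if (1/2) ^ j \<le> \<tau> j then \<tau> j else 0)"
  then have "summable (\<lambda>j. (if (1/2) ^ j \<le> \<tau> j then \<tau> j else 0) + (1/2) ^ j)"
    by (intro summable_add summable_geometric) auto
  then have "summable \<tau>"
    by (rule summable_comparison_test') (use assms(1) in auto)
  with assms(2) show False by simp
qed

section \<open>A path visiting every point infinitely often\<close>

text \<open>
  An oscillation with unbounded amplitude whose speed stays bounded, because the phase grows only
  logarithmically; the factor $1/2$ makes it $1$-Lipschitz.
\<close>

definition walk :: "real \<Rightarrow> real" where
  "walk S = S * sin (ln (1 + S)) / 2"

lemma walk_lipschitz:
  assumes "0 \<le> S" "S \<le> T" shows "\<bar>walk T - walk S\<bar> \<le> T - S"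
proof -
  have D: "(walk has_real_derivative (sin (ln (1 + x)) + x * (cos (ln (1 + x)) / (1 + x))) / 2)
        (at x within {0..})" if "x \<in> {0..}" for x
  proof -
    have "((\<lambda>x. ln (1 + x)) has_real_derivative 1 / (1 + x)) (at x)"
      using that by (auto intro!: derivative_eq_intros)
    then have "((\<lambda>x. sin (ln (1 + x))) has_real_derivative cos (ln (1 + x)) * (1 / (1 + x))) (at x)"
      by (rule DERIV_chain2 [OF DERIV_sin])
    then have "((\<lambda>x. x * sin (ln (1 + x))) has_real_derivative
        1 * sin (ln (1 + x)) + cos (ln (1 + x)) * (1 / (1 + x)) * x) (at x)"
      by (rule DERIV_mult [OF DERIV_ident])
    then have "((\<lambda>x. x * sin (ln (1 + x)) / 2) has_real_derivative
        (1 * sin (ln (1 + x)) + cos (ln (1 + x)) * (1 / (1 + x)) * x) / 2) (at x within {0..})"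
      by (rule has_field_derivative_at_within [OF DERIV_cdivide])
    then show ?thesis by (simp add: walk_def [abs_def] mult_ac)
  qed
  have half_sum_le: "\<bar>b\<bar> \<le> 1 \<Longrightarrow> \<bar>a\<bar> \<le> 1 \<Longrightarrow> norm ((a + b) / 2) \<le> 1" for a b :: real
    by (simp add: field_simps abs_le_iff)
  have "norm (walk T - walk S) \<le> 1 * norm (T - S)"
  proof (rule field_differentiable_bound [OF _ D])
    fix x :: real assume "x \<in> {0..}"
    then have "\<bar>x * (cos (ln (1 + x)) / (1 + x))\<bar> \<le> 1"
    proof -
      have "\<bar>x / (1 + x)\<bar> * \<bar>cos (ln (1 + x))\<bar> \<le> 1 * 1"
        using \<open>x \<in> {0..}\<close> by (intro mult_mono) auto
      then show ?thesis by (simp add: abs_mult abs_divide)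
    qed
    moreover have "\<bar>sin (ln (1 + x))\<bar> \<le> 1" by simp
    ultimately show "norm ((sin (ln (1 + x)) + x * (cos (ln (1 + x)) / (1 + x))) / 2) \<le> 1"
      by (intro half_sum_le) auto
  qed (use assms in auto)
  then show ?thesis using assms by simp
qed

text \<open>
  Between a time of phase $\pi/2 + 2 \pi n$ and the next time of opposite phase the path crosses every
  level that is small compared with these times.
\<close>

lemma walk_recurrent: "\<exists>S\<ge>T. 0 \<le> S \<and> walk S = y"
proof -
  have "\<exists>n::nat. 1 + \<bar>T\<bar> + 2 * \<bar>y\<bar> \<le> real n" by (rule real_arch_simple)
  then obtain n :: nat where n: "1 + \<bar>T\<bar> + 2 * \<bar>y\<bar> \<le> real n" by blast
  define \<theta> where "\<theta> = pi / 2 + 2 * pi * real n"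
  have pi: "real n \<le> 2 * pi * real n"
    using mult_right_mono [of 1 "2 * pi" "real n"] pi_gt3 by simp
  have big: "\<bar>T\<bar> + 2 * \<bar>y\<bar> \<le> exp \<phi> - 1" if "\<theta> \<le> \<phi>" for \<phi>
    using exp_ge_add_one_self [of \<phi>] n pi that pi_gt_zero unfolding \<theta>_def by linarith
  define u where "u = exp \<theta> - 1"
  define v where "v = exp (\<theta> + pi) - 1"
  have uv: "u \<le> v" by (simp add: u_def v_def)
  have "sin \<theta> = 1" unfolding \<theta>_def using cos_2npi [of n] by (simp add: sin_add mult_ac)
  then have u: "walk u = u / 2" by (simp add: walk_def u_def)
  have "sin (\<theta> + pi) = - 1" using \<open>sin \<theta> = 1\<close> by simp
  then have v: "walk v = - v / 2" by (simp add: walk_def v_def)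
  have Tu: "T \<le> u" and yu: "2 * \<bar>y\<bar> \<le> u" and yv: "2 * \<bar>y\<bar> \<le> v"
    using big [of \<theta>] big [of "\<theta> + pi"] pi_gt_zero unfolding u_def v_def by linarith+
  have "0 \<le> u" using yu by linarith
  have "continuous_on {u..v} walk"
    unfolding walk_def [abs_def] using \<open>0 \<le> u\<close> by (intro continuous_intros) auto
  moreover have "walk v \<le> y" "y \<le> walk u"
    using yu yv by (auto simp: u v)
  ultimately obtain S where "u \<le> S" "S \<le> v" "walk S = y"
    using IVT2' [of walk v y u] uv by blast
  then show ?thesis using \<open>0 \<le> u\<close> Tu by (intro exI [of _ S]) auto
qed

text \<open>
  The path passes through \<open>y\<close> at some late time \<open>S\<close>, and \<open>S\<close> lies in one of the intervals of
  lengths \<open>\<rho> j\<close> into which the partial sums cut the half-line. Within that interval the path moves by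
  at most \<open>\<rho> j\<close>.
\<close>

lemma walk_visits_infinitely_often:
  fixes \<rho> :: "nat \<Rightarrow> real"
  assumes \<rho>: "\<And>j. 0 \<le> \<rho> j" and div: "\<not> summable \<rho>"
  shows "\<exists>j\<ge>K. 0 < \<rho> j \<and> \<bar>y - walk (\<Sum>i<j. \<rho> i)\<bar> \<le> \<rho> j"
proof -
  let ?S = "\<lambda>n. \<Sum>i<n. \<rho> i"
  obtain S where S: "?S K \<le> S" "0 \<le> S" "walk S = y" using walk_recurrent by blast
  have "\<exists>n. S < ?S n"
    using filterlim_partial_sums_at_top [OF \<rho> div] unfolding filterlim_at_top_dense
    by (auto simp: eventually_sequentially)
  define n where "n = (LEAST n. S < ?S n)"
  have n: "S < ?S n" using \<open>\<exists>n. S < ?S n\<close> unfolding n_def by (rule LeastI_ex)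
  have mono: "?S k \<le> ?S l" if "k \<le> l" for k l using that \<rho> by (intro sum_mono2) auto
  have "K < n" using n S(1) mono [of n K] by (meson leI less_le_trans not_less)
  then obtain j where j: "n = Suc j" by (cases n) auto
  have "?S j \<le> S" using not_less_Least [of j "\<lambda>n. S < ?S n"] j unfolding n_def by auto
  have "0 < \<rho> j" using n \<open>?S j \<le> S\<close> unfolding j by simp
  have "\<bar>walk S - walk (?S j)\<bar> \<le> S - ?S j"
    using \<rho> by (intro walk_lipschitz \<open>?S j \<le> S\<close> sum_nonneg) auto
  also have "\<dots> \<le> \<rho> j" using n unfolding j by simp
  finally have "\<bar>y - walk (?S j)\<bar> \<le> \<rho> j" using S(3) by simp
  with \<open>0 < \<rho> j\<close> \<open>K < n\<close> j show ?thesis by (intro exI [of _ j]) auto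
qed

section \<open>Quasi-norms\<close>

lemma epowr_ennreal: "0 \<le> x \<Longrightarrow> epowr (ennreal x) r = ennreal (x powr r)"
  by (simp add: epowr_def)

lemma epowr_mono: "x \<le> y \<Longrightarrow> 0 \<le> r \<Longrightarrow> epowr x r \<le> epowr y r"
  by (cases x; cases y) (auto simp: epowr_def powr_mono2 top_unique)

lemma epowr_le: "x \<le> ennreal y \<Longrightarrow> 0 \<le> r \<Longrightarrow> 0 \<le> y \<Longrightarrow> epowr x r \<le> ennreal (y powr r)"
  using epowr_mono [of x "ennreal y" r] by (simp add: epowr_ennreal)

lemma epowr_ge: "ennreal y \<le> x \<Longrightarrow> 0 \<le> r \<Longrightarrow> 0 \<le> y \<Longrightarrow> ennreal (y powr r) \<le> epowr x r"
  using epowr_mono [of "ennreal y" x r] by (simp add: epowr_ennreal)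

lemma ennreal_eq_infinityI:
  assumes "\<And>b. 0 \<le> b \<Longrightarrow> ennreal b \<le> x" shows "x = \<infinity>"
proof (cases x)
  case (real b)
  then show ?thesis using assms [of "b + 1"] by (simp add: ennreal_le_iff)
qed simp

lemma finite_exponent:
  assumes "0 < p" "ennreal p < q" "q < \<infinity>"
  shows "q = ennreal (enn2real q)" "p < enn2real q"
  using assms by (cases q; simp add: ennreal_less_iff)+

lemma Lp_norm_le:
  assumes "(\<integral>\<^sup>+x. ennreal (\<bar>f x\<bar> powr p) \<partial>lebesgue) \<le> ennreal B" "0 < p" "0 \<le> B"
  shows "Lp_norm (ennreal p) f \<le> ennreal (B powr (1 / p))"
  using assms by (simp add: Lp_norm_def epowr_le)

lemma Lp_norm_ge:
  assumes "ennreal B \<le> (\<integral>\<^sup>+x. ennreal (\<bar>f x\<bar> powr p) \<partial>lebesgue)" "0 < p" "0 \<le> B"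
  shows "ennreal (B powr (1 / p)) \<le> Lp_norm (ennreal p) f"
  using assms by (simp add: Lp_norm_def epowr_ge)

section \<open>A discrete Hardy inequality\<close>

text \<open>
  The exponent \<open>(j - k) + (k - j)\<close> is $|j - k|$, since one of the truncated differences is zero.
\<close>

lemma sum_dist_power_le:
  fixes \<theta> :: real
  assumes "0 \<le> \<theta>" "\<theta> < 1"
  shows "(\<Sum>k<n. \<theta> ^ ((j - k) + (k - j))) \<le> 2 / (1 - \<theta>)"
proof -
  have geo: "(\<Sum>i<n. \<theta> ^ i) \<le> 1 / (1 - \<theta>)" for n
    using assms by (simp add: sum_gp_strict divide_right_mono)
  have "(\<Sum>k<n. \<theta> ^ ((j - k) + (k - j))) \<le> (\<Sum>k<j + n. \<theta> ^ ((j - k) + (k - j)))"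
    using assms by (intro sum_mono2) auto
  also have "\<dots> = (\<Sum>k<j. \<theta> ^ ((j - k) + (k - j))) + (\<Sum>i<n. \<theta> ^ ((j - (i + j)) + (i + j - j)))"
    unfolding atLeast0LessThan [symmetric]
    using sum.atLeastLessThan_concat [of 0 j "j + n" "\<lambda>k. \<theta> ^ ((j - k) + (k - j))"]
      sum.shift_bounds_nat_ivl [of "\<lambda>k. \<theta> ^ ((j - k) + (k - j))" 0 j n]
    by (simp add: add_ac)
  also have "(\<Sum>k<j. \<theta> ^ ((j - k) + (k - j))) = (\<Sum>k<j. \<theta> ^ Suc k)"
    by (subst sum.nat_diff_reindex [symmetric]) (auto intro!: sum.cong)
  also have "\<dots> \<le> (\<Sum>k<j. \<theta> ^ k)"
    using assms by (intro sum_mono) (simp add: mult_left_le_one_le)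
  finally show ?thesis using geo [of j] geo [of n] by simp
qed

lemma
  fixes \<theta> :: real
  assumes "0 \<le> \<theta>" "\<theta> < 1"
  shows summable_dist_power: "summable (\<lambda>j. \<theta> ^ ((j - k) + (k - j)))"
    and suminf_dist_power_le: "(\<Sum>j. \<theta> ^ ((j - k) + (k - j))) \<le> 2 / (1 - \<theta>)"
proof -
  have le: "(\<Sum>j<n. \<theta> ^ ((j - k) + (k - j))) \<le> 2 / (1 - \<theta>)" for n
    using sum_dist_power_le [OF assms, where n = n and j = k] by (simp add: add.commute)
  show s: "summable (\<lambda>j. \<theta> ^ ((j - k) + (k - j)))"
    by (rule bounded_imp_summable [where B = "2 / (1 - \<theta>)"])
       (use assms le in \<open>auto simp only: lessThan_Suc_atMost [symmetric] zero_le_power\<close>)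
  show "(\<Sum>j. \<theta> ^ ((j - k) + (k - j))) \<le> 2 / (1 - \<theta>)"
    by (rule suminf_le_const [OF s le])
qed

text \<open>
  The case of $\ell^\infty$, stated with two rates: \<open>m\<close> itself need not be bounded, as long as part of
  the decay of the kernel makes it so. This is what the case of $\ell^r$ below needs.
\<close>

lemma dist_power_convolution_bounded:
  fixes \<theta> :: real
  assumes \<theta>: "0 \<le> \<theta>" "\<theta> < 1" and m: "\<And>j. 0 \<le> m j" "\<And>j. \<theta> ^ ((j - k) + (k - j)) * m j \<le> \<theta>' ^ ((j - k) + (k - j)) * B"
    and \<theta>': "0 \<le> \<theta>'" "\<theta>' < 1" and "0 \<le> B"
  shows "(\<Sum>j. ennreal (\<theta> ^ ((j - k) + (k - j)) * m j)) \<le> ennreal (2 / (1 - \<theta>') * B)"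
proof -
  have "(\<Sum>j. ennreal (\<theta> ^ ((j - k) + (k - j)) * m j))
      \<le> (\<Sum>j. ennreal (\<theta>' ^ ((j - k) + (k - j)) * B))"
    by (intro suminf_le ennreal_leI m(2)) auto
  also have "\<dots> = ennreal (\<Sum>j. \<theta>' ^ ((j - k) + (k - j)) * B)"
    using \<theta>' \<open>0 \<le> B\<close> by (intro suminf_ennreal2 summable_mult2 summable_dist_power) auto
  also have "\<dots> = ennreal ((\<Sum>j. \<theta>' ^ ((j - k) + (k - j))) * B)"
    using suminf_mult2 [OF summable_dist_power [OF \<theta>'], of k B] by simp
  also have "\<dots> \<le> ennreal (2 / (1 - \<theta>') * B)"
    using suminf_dist_power_le [OF \<theta>', of k] \<open>0 \<le> B\<close> by (intro ennreal_leI mult_right_mono)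
  finally show ?thesis .
qed

text \<open>
  Young's inequality for a kernel with geometric decay, valid for every \<open>r > 0\<close>: one half of the decay
  turns the sum over \<open>j\<close> into a supremum, the other half is kept as a weight. The supremum is then bounded
  by the \<open>r\<close>-th root of the sum of the \<open>r\<close>-th powers, and summing over \<open>k\<close> first finishes the proof.
\<close>

lemma dist_power_convolution_powr_summable:
  fixes \<theta> :: real
  assumes \<theta>: "0 < \<theta>" "\<theta> < 1" and "0 < r" and m: "\<And>j. 0 \<le> m j" "summable (\<lambda>j. m j powr r)"
  obtains Q where "\<And>k. 0 \<le> Q k" "summable (\<lambda>k. Q k powr r)"
    "\<And>k. (\<Sum>j. ennreal (\<theta> ^ ((j - k) + (k - j)) * m j)) \<le> ennreal (Q k)"
proof -
  define \<eta> where "\<eta> = sqrt \<theta>"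
  have \<eta>: "0 < \<eta>" "\<eta> < 1" "\<eta> * \<eta> = \<theta>" using \<theta> by (auto simp: \<eta>_def)
  define \<zeta> where "\<zeta> = \<eta> powr r"
  have \<zeta>: "0 < \<zeta>" "\<zeta> < 1" using \<eta> \<open>0 < r\<close> powr_less_mono2 [of r \<eta> 1] by (auto simp: \<zeta>_def)
  define e where "e j k = \<zeta> ^ ((j - k) + (k - j)) * m j powr r" for j k
  have e0: "0 \<le> e j k" for j k using \<zeta> by (simp add: e_def)
  have se: "summable (\<lambda>j. e j k)" for k
  proof (rule summable_comparison_test' [OF m(2)])
    show "norm (e j k) \<le> m j powr r" for j
      using \<zeta> by (simp add: e_def abs_mult power_le_one mult_left_le_one_le)
  qed
  define P where "P k = (\<Sum>j. e j k)" for k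
  have P0: "0 \<le> P k" for k unfolding P_def by (rule suminf_nonneg [OF se e0])
  have "(\<Sum>k\<le>n. P k) \<le> 2 / (1 - \<zeta>) * (\<Sum>j. m j powr r)" for n
  proof -
    have "(\<Sum>k\<le>n. P k) = (\<Sum>j. \<Sum>k\<le>n. e j k)"
      unfolding P_def by (rule suminf_sum [symmetric]) (rule se)
    also have "\<dots> \<le> (\<Sum>j. 2 / (1 - \<zeta>) * m j powr r)"
    proof (rule suminf_le)
      fix j
      have "(\<Sum>k\<le>n. e j k) = (\<Sum>k<Suc n. \<zeta> ^ ((j - k) + (k - j))) * m j powr r"
        by (simp only: e_def sum_distrib_right lessThan_Suc_atMost)
      also have "\<dots> \<le> 2 / (1 - \<zeta>) * m j powr r"
        by (intro mult_right_mono sum_dist_power_le) (use \<zeta> in auto)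
      finally show "(\<Sum>k\<le>n. e j k) \<le> 2 / (1 - \<zeta>) * m j powr r" .
    qed (intro summable_sum se summable_mult m(2))+
    also have "\<dots> = 2 / (1 - \<zeta>) * (\<Sum>j. m j powr r)" by (rule suminf_mult [OF m(2)])
    finally show ?thesis .
  qed
  then have sP: "summable P" by (rule bounded_imp_summable [OF P0])
  show thesis
  proof
    let ?c = "2 / (1 - \<eta>)"
    show "0 \<le> ?c * P k powr (1 / r)" for k using \<eta> by simp
    have "(?c * P k powr (1 / r)) powr r = ?c powr r * P k" for k
      using \<eta> \<open>0 < r\<close> P0 [of k] by (subst powr_mult) (auto simp: powr_powr)
    then show "summable (\<lambda>k. (?c * P k powr (1 / r)) powr r)"
      using summable_mult [OF sP, of "?c powr r"] by simp
    show "(\<Sum>j. ennreal (\<theta> ^ ((j - k) + (k - j)) * m j)) \<le> ennreal (?c * P k powr (1 / r))" for k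
    proof (rule dist_power_convolution_bounded)
      fix j
      let ?i = "(j - k) + (k - j)"
      have "(\<eta> ^ ?i * m j) powr r = e j k"
        using \<eta> m(1) [of j] by (simp add: e_def \<zeta>_def powr_mult powr_power powr_realpow [symmetric] powr_powr mult.commute del: of_nat_add)
      also have "\<dots> \<le> P k"
        unfolding P_def using sum_le_suminf [OF se, of "{j}" k] e0 by simp
      finally have "((\<eta> ^ ?i * m j) powr r) powr (1 / r) \<le> P k powr (1 / r)"
        using \<open>0 < r\<close> by (intro powr_mono2) auto
      then have "\<eta> ^ ?i * m j \<le> P k powr (1 / r)"
        using \<eta> m(1) [of j] \<open>0 < r\<close> by (simp add: powr_powr)
      then have "\<eta> ^ ?i * (\<eta> ^ ?i * m j) \<le> \<eta> ^ ?i * P k powr (1 / r)"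
        using \<eta> by (intro mult_left_mono) auto
      then show "\<theta> ^ ?i * m j \<le> \<eta> ^ ?i * P k powr (1 / r)"
        by (simp add: \<eta>(3) [symmetric] power_mult_distrib mult.assoc)
    qed (use \<theta> \<eta> m in auto)
  qed
qed

text \<open>
  The $p$-th power of the size of the differences with step $t \sim 2^{-k}$ of a bump at scale $2^{-j}$, relative to
  $t^{sp}$.
  Coarse bumps ($j < k$) profit from the smoothness \<open>M > s\<close>, fine bumps ($j \ge k$) from the factor
  $2^{-js}$ alone; both yield decay in $|j - k|$.
\<close>

lemma dyadic_kernel_le:
  fixes t p s :: real
  assumes t: "(1/2) ^ Suc k < t" "t \<le> (1/2) ^ k" and "0 < p" "0 < s" "s < real M"
  shows "(min 1 (t / (1/2) ^ Suc j)) powr (real M * p) * ((1/2) ^ j) powr (s * p)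
    \<le> 2 powr (real M * p) * t powr (s * p) * ((1/2) powr (min s (real M - s) * p)) ^ ((j - k) + (k - j))"
proof -
  let ?\<theta> = "(1/2 :: real) powr (min s (real M - s) * p)"
  have pw: "((1/2 :: real) ^ n) powr a = ((1/2) powr a) ^ n" for n a
    by (simp add: powr_power powr_realpow [symmetric] powr_powr mult.commute)
  have t0: "0 < t" using t(1) by (meson less_trans zero_less_power half_gt_zero zero_less_one)
  show ?thesis
  proof (cases "k \<le> j")
    case True
    have "(1/2) ^ j = (1/2) ^ k * (1/2 :: real) ^ (j - k)"
      using True by (simp add: power_add [symmetric])
    also have "\<dots> \<le> (2 * t) * (1/2) ^ (j - k)" using t(1) by (intro mult_right_mono) auto
    finally have "((1/2) ^ j) powr (s * p) \<le> ((2 * t) * (1/2) ^ (j - k)) powr (s * p)"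
      using \<open>0 < p\<close> \<open>0 < s\<close> by (intro powr_mono2) auto
    also have "\<dots> = 2 powr (s * p) * t powr (s * p) * ((1/2) powr (s * p)) ^ (j - k)"
      using t0 by (simp add: powr_mult pw)
    also have "\<dots> \<le> 2 powr (real M * p) * t powr (s * p) * ?\<theta> ^ (j - k)"
      using assms
      by (intro mult_mono [OF mult_right_mono [OF powr_mono] power_mono [OF powr_mono']]) auto
    finally have "((1/2) ^ j) powr (s * p) \<le> 2 powr (real M * p) * t powr (s * p) * ?\<theta> ^ (j - k)" .
    moreover have "(min 1 (t / (1/2) ^ Suc j)) powr (real M * p) \<le> 1"
      using powr_mono2 [of "real M * p" "min 1 (t / (1/2) ^ Suc j)" 1] t0 \<open>0 < p\<close> by simp
    ultimately have "(min 1 (t / (1/2) ^ Suc j)) powr (real M * p) * ((1/2) ^ j) powr (s * p)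
        \<le> 1 * (2 powr (real M * p) * t powr (s * p) * ?\<theta> ^ (j - k))"
      by (intro mult_mono) auto
    then show ?thesis using True by simp
  next
    case False
    define d where "d = (1/2 :: real) ^ j"
    have d: "0 < d" by (simp add: d_def)
    have "(min 1 (t / (1/2) ^ Suc j)) powr (real M * p) \<le> (2 * (t / d)) powr (real M * p)"
      using t0 \<open>0 < p\<close> d by (intro powr_mono2) (auto simp: d_def min_le_iff_disj mult.commute)
    then have "(min 1 (t / (1/2) ^ Suc j)) powr (real M * p) * d powr (s * p)
       \<le> (2 * (t / d)) powr (real M * p) * d powr (s * p)"
      by (intro mult_right_mono) auto
    also have "\<dots> = 2 powr (real M * p) * t powr (s * p) * (t / d) powr ((real M - s) * p)"
    proof -
      have a: "(t / d) powr (real M * p) = (t / d) powr ((real M - s) * p) * (t / d) powr (s * p)"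
        by (simp add: powr_add [symmetric] algebra_simps)
      have b: "(t / d) powr (s * p) * d powr (s * p) = t powr (s * p)"
        using d t0 by (simp add: powr_mult [symmetric])
      have c: "(2 * (t / d)) powr (real M * p) = 2 powr (real M * p) * (t / d) powr (real M * p)"
        by (rule powr_mult)
      have "(2 * (t / d)) powr (real M * p) * d powr (s * p)
          = 2 powr (real M * p) * (t / d) powr ((real M - s) * p) * ((t / d) powr (s * p) * d powr (s * p))"
        unfolding c a by (simp only: mult_ac)
      then show ?thesis unfolding b by (simp only: mult_ac)
    qed
    also have "(t / d) powr ((real M - s) * p) \<le> ((1/2) ^ (k - j)) powr ((real M - s) * p)"
    proof (rule powr_mono2)
      have "(1/2) ^ k = d * (1/2 :: real) ^ (k - j)"
        using False by (simp add: d_def power_add [symmetric])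
      with t(2) d show "t / d \<le> (1/2) ^ (k - j)" by (simp add: field_simps)
    qed (use assms d t0 in auto)
    also have "\<dots> \<le> ?\<theta> ^ (k - j)"
      unfolding pw using assms by (intro power_mono powr_mono') auto
    finally show ?thesis using False by (simp add: d_def mult_left_mono)
  qed
qed

lemma exists_dyadic_shell:
  assumes "0 < t" "t \<le> (1::real)"
  obtains k where "(1/2) ^ Suc k < t" "t \<le> (1/2) ^ k"
proof -
  have "\<exists>n. (1/2) ^ n < t" using assms by (intro real_arch_pow_inv) auto
  define n where "n = (LEAST n. (1/2) ^ n < t)"
  have n: "(1/2) ^ n < t" unfolding n_def by (rule LeastI_ex) fact
  with assms obtain k where k: "n = Suc k" by (cases n) auto
  have "t \<le> (1/2) ^ k" using not_less_Least [of k "\<lambda>n. (1/2) ^ n < t"] k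
    unfolding n_def by (simp add: not_less)
  with n k that show thesis by blast
qed


section \<open>Membership criteria for the Besov spaces\<close>

text \<open>
  Membership of a function whose differences are those of a sum of non-interacting bumps at the scales
  $2^{-j}$ with weights \<open>m j\<close>. On the shell $2^{-k-1} < |h| \le 2^{-k}$ the preceding section bounds the
  $L^p$ norm by $|h|^s$ times a sequence in $\ell^q$, and the shells have bounded measure with respect to
  $|h|^{-n} dh$, where $n$ is the dimension.
\<close>

lemma besov_space_dyadicI:
  fixes f :: "'a::euclidean_space \<Rightarrow> real" and q :: ennreal
  assumes f: "f \<in> Lp_space (ennreal p)"
    and p: "0 < p" "ennreal p < q" and s: "0 < s" "s < real M"
    and m: "\<And>j. 0 \<le> m j" "q = \<infinity> \<Longrightarrow> \<forall>j. m j \<le> B"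
      "q < \<infinity> \<Longrightarrow> summable (\<lambda>j. m j powr (enn2real q / p))"
    and "0 \<le> K"
    and diff: "\<And>h. h \<noteq> 0 \<Longrightarrow> norm h \<le> 1 \<Longrightarrow>
      (\<integral>\<^sup>+x. ennreal (\<bar>fin_diff M h f x\<bar> powr p) \<partial>lebesgue)
      \<le> (\<Sum>j. ennreal (K * (min 1 (norm h / (1/2) ^ Suc j)) powr (real M * p) * ((1/2) ^ j) powr (s * p) * m j))"
  shows "f \<in> besov_space M s (ennreal p) q"
proof -
  define \<theta> where "\<theta> = (1/2 :: real) powr (min s (real M - s) * p)"
  have \<theta>: "0 < \<theta>" "\<theta> < 1"
    using p s powr_less_mono' [of "1/2" 0 "min s (real M - s) * p"] by (auto simp: \<theta>_def)
  define L where "L = K * 2 powr (real M * p)"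
  have "0 \<le> L" using \<open>0 \<le> K\<close> by (simp add: L_def)
  have shell: "Lp_norm (ennreal p) (fin_diff M h f) \<le> ennreal ((L * Q) powr (1 / p) * norm h powr s)"
    if h: "(1/2) ^ Suc k < norm h" "norm h \<le> (1/2) ^ k"
      and Q: "(\<Sum>j. ennreal (\<theta> ^ ((j - k) + (k - j)) * m j)) \<le> ennreal Q" "0 \<le> Q" for h k Q
  proof -
    have "h \<noteq> 0" using h(1) by (metis less_asym norm_zero zero_less_power half_gt_zero zero_less_one)
    have "norm h \<le> 1" using h(2) power_le_one [of "1/2 :: real" k] by simp
    have "(\<integral>\<^sup>+x. ennreal (\<bar>fin_diff M h f x\<bar> powr p) \<partial>lebesgue)
        \<le> (\<Sum>j. ennreal (K * (min 1 (norm h / (1/2) ^ Suc j)) powr (real M * p) * ((1/2) ^ j) powr (s * p) * m j))"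
      by (rule diff) fact+
    also have "\<dots> \<le> (\<Sum>j. ennreal (L * norm h powr (s * p)) * ennreal (\<theta> ^ ((j - k) + (k - j)) * m j))"
    proof (rule suminf_le)
      fix j
      have "K * (min 1 (norm h / (1/2) ^ Suc j)) powr (real M * p) * ((1/2) ^ j) powr (s * p) * m j
        = K * m j * ((min 1 (norm h / (1/2) ^ Suc j)) powr (real M * p) * ((1/2) ^ j) powr (s * p))"
        by (simp only: mult_ac)
      also have "\<dots> \<le> K * m j * (2 powr (real M * p) * norm h powr (s * p) * \<theta> ^ ((j - k) + (k - j)))"
        unfolding \<theta>_def using m(1) \<open>0 \<le> K\<close> by (intro mult_left_mono dyadic_kernel_le h p s) auto
      also have "\<dots> = L * norm h powr (s * p) * (\<theta> ^ ((j - k) + (k - j)) * m j)"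
        by (simp only: L_def mult_ac)
      finally show "ennreal (K * (min 1 (norm h / (1/2) ^ Suc j)) powr (real M * p) * ((1/2) ^ j) powr (s * p) * m j)
        \<le> ennreal (L * norm h powr (s * p)) * ennreal (\<theta> ^ ((j - k) + (k - j)) * m j)"
        using \<open>0 \<le> L\<close> m(1) [of j] \<theta> by (simp add: ennreal_mult [symmetric] ennreal_leI)
    qed auto
    also have "\<dots> \<le> ennreal (L * norm h powr (s * p)) * ennreal Q"
      using Q(1) by (simp add: mult_left_mono)
    also have "\<dots> = ennreal (L * Q * norm h powr (s * p))"
      using \<open>0 \<le> L\<close> Q(2) by (simp add: ennreal_mult [symmetric] mult_ac)
    finally have "Lp_norm (ennreal p) (fin_diff M h f) \<le> ennreal ((L * Q * norm h powr (s * p)) powr (1 / p))"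
      using \<open>0 \<le> L\<close> Q(2) p(1) by (intro Lp_norm_le) auto
    also have "(L * Q * norm h powr (s * p)) powr (1 / p) = (L * Q) powr (1 / p) * norm h powr s"
      using \<open>0 \<le> L\<close> Q(2) p(1) by (subst powr_mult) (auto simp: powr_powr)
    finally show ?thesis .
  qed
  have "besov_seminorm M s (ennreal p) q f < \<infinity>"
  proof (cases "q = \<infinity>")
    case True
    define B' where "B' = max B 0"
    have B': "m j \<le> B'" "0 \<le> B'" for j using m(2) [OF True] by (auto simp: B'_def le_max_iff_disj)
    let ?Q = "2 / (1 - \<theta>) * B'"
    have Q: "0 \<le> ?Q" using \<theta> B' by simp
    have "ennreal (norm h powr (- s)) * Lp_norm (ennreal p) (fin_diff M h f) \<le> ennreal ((L * ?Q) powr (1 / p))"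
      if h: "h \<in> cball 0 1 - {0}" for h
    proof -
      obtain k where k: "(1/2) ^ Suc k < norm h" "norm h \<le> (1/2) ^ k"
        using exists_dyadic_shell [of "norm h"] h by auto
      have "(\<Sum>j. ennreal (\<theta> ^ ((j - k) + (k - j)) * m j)) \<le> ennreal ?Q"
        by (rule dist_power_convolution_bounded) (use \<theta> B' m(1) in \<open>auto intro!: mult_left_mono\<close>)
      then have "Lp_norm (ennreal p) (fin_diff M h f) \<le> ennreal ((L * ?Q) powr (1 / p) * norm h powr s)"
        by (rule shell [OF k _ Q])
      then have "ennreal (norm h powr (- s)) * Lp_norm (ennreal p) (fin_diff M h f)
          \<le> ennreal (norm h powr (- s)) * ennreal ((L * ?Q) powr (1 / p) * norm h powr s)"
        by (rule mult_left_mono) simp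
      also have "\<dots> = ennreal ((L * ?Q) powr (1 / p) * (norm h powr s * norm h powr (- s)))"
        by (simp add: ennreal_mult [symmetric] mult_ac)
      also have "norm h powr s * norm h powr (- s) = 1"
        using h by (simp add: powr_add [symmetric])
      finally show ?thesis by simp
    qed
    then have "besov_seminorm M s (ennreal p) q f \<le> ennreal ((L * ?Q) powr (1 / p))"
      unfolding besov_seminorm_def using True by (simp only: refl if_True) (rule SUP_least)
    then show ?thesis by (rule le_less_trans) simp
  next
    case False
    then have qfin: "q < \<infinity>" by (simp add: top.not_eq_extremum)
    define r where "r = enn2real q"
    have r: "q = ennreal r" "p < r"
      using finite_exponent [OF p qfin] unfolding r_def by blast+
    let ?N = "DIM('a)"
    obtain Q where Q: "\<And>k. 0 \<le> Q k" "summable (\<lambda>k. Q k powr (r / p))"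
      "\<And>k. (\<Sum>j. ennreal (\<theta> ^ ((j - k) + (k - j)) * m j)) \<le> ennreal (Q k)"
      by (rule dist_power_convolution_powr_summable [OF \<theta>, of "r / p" m])
         (use m(1) m(3) [OF qfin, folded r_def] p(1) r(2) in auto)
    define w where "w k = (L * Q k) powr (r / p)" for k
    have w: "0 \<le> w k" for k by (simp add: w_def)
    have sw: "summable w"
      unfolding w_def [abs_def] using \<open>0 \<le> L\<close> Q(1) summable_mult [OF Q(2)] by (simp add: powr_mult)
    let ?I = "\<lambda>h. epowr (Lp_norm (ennreal p) (fin_diff M h f)) r
        * ennreal (1 / norm h powr (real ?N + s * r)) * indicator (cball 0 1) h"
    let ?J = "\<lambda>k h::'a. ennreal (w k * (2 ^ Suc k) ^ ?N) * indicator (cball 0 ((1/2) ^ k)) h"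
    have le: "?I h \<le> (\<Sum>k. ?J k h)" for h
    proof (cases "h = 0 \<or> 1 < norm h")
      case True
      then show ?thesis by (auto simp: indicator_def)
    next
      case hf: False
      then obtain k where k: "(1/2) ^ Suc k < norm h" "norm h \<le> (1/2) ^ k"
        using exists_dyadic_shell [of "norm h"] by auto
      have "epowr (Lp_norm (ennreal p) (fin_diff M h f)) r
          \<le> ennreal (((L * Q k) powr (1 / p) * norm h powr s) powr r)"
        using r p by (intro epowr_le shell [OF k Q(3) Q(1)]) auto
      also have "((L * Q k) powr (1 / p) * norm h powr s) powr r = w k * norm h powr (s * r)"
        by (subst powr_mult) (auto simp: w_def powr_powr)
      finally have "?I h \<le> ennreal (w k * norm h powr (s * r)) * ennreal (1 / norm h powr (real ?N + s * r))"
        using hf by (simp add: mult_right_mono)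
      also have "\<dots> = ennreal (w k * (1 / norm h) ^ ?N)"
        using w [of k] hf by (simp add: ennreal_mult [symmetric] powr_add powr_realpow power_one_over field_simps)
      also have "\<dots> \<le> ennreal (w k * (2 ^ Suc k) ^ ?N)"
      proof (intro ennreal_leI mult_left_mono power_mono w)
        show "1 / norm h \<le> 2 ^ Suc k"
          using k(1) hf by (simp add: power_one_over field_simps)
      qed simp
      also have "\<dots> = ?J k h" using k(2) by simp
      also have "\<dots> = (\<Sum>i\<in>{k}. ?J i h)"
        by (simp only: sum.insert finite.emptyI empty_iff not_False_eq_True sum.empty add_0_right)
      also have "\<dots> \<le> (\<Sum>k. ?J k h)" by (rule sum_le_suminf) auto
      finally show ?thesis .
    qed
    have "(\<integral>\<^sup>+h. ?I h \<partial>lebesgue) \<le> (\<integral>\<^sup>+h. (\<Sum>k. ?J k h) \<partial>lebesgue)"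
      by (rule nn_integral_mono) (rule le)
    also have "\<dots> = (\<integral>\<^sup>+h. (\<Sum>k. ?J k h) \<partial>lborel)" by (rule nn_integral_completion)
    also have "\<dots> = (\<Sum>k. \<integral>\<^sup>+h. ?J k h \<partial>lborel)"
      by (intro nn_integral_suminf borel_measurable_times_ennreal borel_measurable_const borel_measurable_indicator) simp
    also have "\<dots> = (\<Sum>k. ennreal (unit_ball_vol ?N * 2 ^ ?N * w k))"
    proof (rule suminf_cong)
      fix k
      have "(\<integral>\<^sup>+h. ?J k h \<partial>lborel) = ennreal (w k * (2 ^ Suc k) ^ ?N) * emeasure lborel (cball (0::'a) ((1/2) ^ k))"
        by (rule nn_integral_cmult_indicator) simp
      also have "\<dots> = ennreal (w k * (2 ^ Suc k) ^ ?N * (unit_ball_vol ?N * ((1/2) ^ k) ^ ?N))"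
        using w by (subst emeasure_cball) (auto simp: ennreal_mult [symmetric] simp del: power_Suc)
      also have "w k * (2 ^ Suc k) ^ ?N * (unit_ball_vol ?N * ((1/2) ^ k) ^ ?N)
          = unit_ball_vol ?N * w k * (2 ^ Suc k * (1/2) ^ k) ^ ?N"
        by (simp only: power_mult_distrib mult_ac)
      also have "2 ^ Suc k * (1/2) ^ k = (2 :: real)" by (simp add: power_one_over)
      finally show "(\<integral>\<^sup>+h. ?J k h \<partial>lborel) = ennreal (unit_ball_vol ?N * 2 ^ ?N * w k)"
        by (simp add: mult_ac)
    qed
    also have "\<dots> < \<infinity>"
      using summable_mult [OF sw, of "unit_ball_vol ?N * 2 ^ ?N"] w by (subst suminf_ennreal2) auto
    finally have fin: "(\<integral>\<^sup>+h. ?I h \<partial>lebesgue) < \<infinity>" .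
    then show ?thesis
      using False by (auto simp: besov_seminorm_def r_def [symmetric] epowr_def)
  qed
  with f show ?thesis by (simp add: besov_space_def)
qed

lemma admissible_pos: "admissible \<Psi> \<Longrightarrow> 0 < t \<Longrightarrow> t \<le> 1 \<Longrightarrow> 0 < \<Psi> t"
  by (auto simp: admissible_def)

text \<open>
  For increasing $\Psi$ the left end point gives the bound with constant $1$. For decreasing $\Psi$, with
  $j = i + 1$, one compares with $2^{-2i} \le 2^{-j}$, which is where $j \ge 2$ enters.
\<close>

lemma admissible_ge_on_dyadic_interval:
  assumes "admissible \<Psi>"
  obtains c where "0 < c"
    "\<And>j t. 2 \<le> j \<Longrightarrow> (1/2) ^ j \<le> t \<Longrightarrow> t \<le> 2 * (1/2) ^ j \<Longrightarrow> c * \<Psi> ((1/2) ^ j) \<le> \<Psi> t"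
proof -
  obtain c C where c: "0 < c" "\<And>j::nat. c * \<Psi> ((1/2) ^ (2 * j)) \<le> \<Psi> ((1/2) ^ j)"
    using assms unfolding admissible_def by blast
  have "min 1 c * \<Psi> ((1/2) ^ j) \<le> \<Psi> t"
    if j: "2 \<le> j" and t: "(1/2) ^ j \<le> t" "t \<le> 2 * (1/2) ^ j" for j t
  proof -
    obtain i where i: "j = Suc i" "1 \<le> i" using j by (cases j) auto
    have half: "0 < (1/2 :: real) ^ n" "(1/2 :: real) ^ n \<le> 1" for n by (simp_all add: power_le_one)
    have t': "t \<le> (1/2) ^ i" using t(2) i by simp
    have "0 < t" using t(1) half(1) [of j] by linarith
    then have I: "t \<in> {0<..1}" using t' half(2) [of i] by simp
    have pos: "0 < \<Psi> ((1/2) ^ n)" for n using admissible_pos [OF assms] half by blast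
    have "mono_on {0<..1} \<Psi> \<or> antimono_on {0<..1} \<Psi>" using assms by (simp add: admissible_def)
    then show ?thesis
    proof
      assume mono: "mono_on {0<..1} \<Psi>"
      have "\<Psi> ((1/2) ^ j) \<le> \<Psi> t"
        using t(1) I half by (intro mono_onD [OF mono]) auto
      moreover have "min 1 c * \<Psi> ((1/2) ^ j) \<le> 1 * \<Psi> ((1/2) ^ j)"
        using pos [of j] by (intro mult_right_mono) auto
      ultimately show ?thesis by simp
    next
      assume anti: "antimono_on {0<..1} \<Psi>"
      have "(1/2 :: real) ^ (2 * i) \<le> (1/2) ^ j" using i by (intro power_decreasing) auto
      then have "\<Psi> ((1/2) ^ j) \<le> \<Psi> ((1/2) ^ (2 * i))"
        using half by (intro monotone_onD [OF anti, simplified]) auto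
      then have "min 1 c * \<Psi> ((1/2) ^ j) \<le> c * \<Psi> ((1/2) ^ (2 * i))"
        using pos [of j] c(1) by (intro mult_mono) auto
      also have "\<dots> \<le> \<Psi> ((1/2) ^ i)" by (rule c(2))
      also have "\<dots> \<le> \<Psi> t"
        using half t' I by (intro monotone_onD [OF anti, simplified]) auto
      finally show ?thesis .
    qed
  qed
  with c(1) show thesis by (intro that [of "min 1 c"]) auto
qed

text \<open>
  A single scale already forces the seminorm to be large: a large difference for one step of length at
  most $2^{-j}$ is felt by all $t$ in $[2^{-j}, 2^{1-j}]$, an interval of measure comparable with its end
  points. For finite \<open>q\<close> it is this interval over which the integral is bounded from below.
\<close>

lemma not_in_gen_besov_spaceI:
  fixes g :: "'a::euclidean_space \<Rightarrow> real" and q :: ennreal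
  assumes adm: "admissible \<Psi>" and p: "0 < p" "ennreal p < q"
    and s: "0 < s"
    and big: "\<And>R::real. \<exists>j\<ge>2. \<exists>h. norm h \<le> (1/2) ^ j \<and>
       ennreal (R * ((1/2) ^ j) powr s / \<Psi> ((1/2) ^ j)) \<le> Lp_norm (ennreal p) (fin_diff M h g)"
  shows "g \<notin> gen_besov_space M s \<Psi> (ennreal p) q"
proof -
  have half: "0 < (1/2 :: real) ^ n" "(1/2 :: real) ^ n \<le> 1" for n by (simp_all add: power_le_one)
  have pos: "0 < \<Psi> ((1/2) ^ n)" for n using admissible_pos [OF adm] half by blast
  have "gen_besov_seminorm M s \<Psi> (ennreal p) q g = \<infinity>"
  proof (cases "q = \<infinity>")
    case True
    have "ennreal R \<le> gen_besov_seminorm M s \<Psi> (ennreal p) q g" if "0 \<le> R" for R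
    proof -
      obtain j h where jh: "norm h \<le> (1/2) ^ j"
        "ennreal (R * ((1/2) ^ j) powr s / \<Psi> ((1/2) ^ j)) \<le> Lp_norm (ennreal p) (fin_diff M h g)"
        using big by blast
      let ?t = "(1/2 :: real) ^ j"
      have "R = (?t powr (- s) * \<Psi> ?t) * (R * ?t powr s / \<Psi> ?t)"
        using pos [of j] half [of j] by (simp add: powr_minus field_simps)
      then have "ennreal R = ennreal (?t powr (- s) * \<Psi> ?t) * ennreal (R * ?t powr s / \<Psi> ?t)"
        using pos [of j] \<open>0 \<le> R\<close> by (subst ennreal_mult [symmetric]) auto
      also have "\<dots> \<le> ennreal (?t powr (- s) * \<Psi> ?t) * (SUP h\<in>cball 0 ?t. Lp_norm (ennreal p) (fin_diff M h g))"
        by (intro mult_left_mono order_trans [OF jh(2)] SUP_upper) (use jh(1) in auto)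
      also have "\<dots> \<le> gen_besov_seminorm M s \<Psi> (ennreal p) q g"
        unfolding gen_besov_seminorm_def using True half
        by (simp only: refl if_True) (rule SUP_upper [where i = ?t], simp)
      finally show ?thesis .
    qed
    then show ?thesis by (rule ennreal_eq_infinityI)
  next
    case False
    then have qfin: "q < \<infinity>" by (simp add: top.not_eq_extremum)
    define r where "r = enn2real q"
    have r: "q = ennreal r" "0 < r"
      using finite_exponent [OF p qfin] p(1) unfolding r_def by linarith+
    obtain c where c: "0 < c" "\<And>j t. 2 \<le> j \<Longrightarrow> (1/2) ^ j \<le> t \<Longrightarrow> t \<le> 2 * (1/2) ^ j \<Longrightarrow> c * \<Psi> ((1/2) ^ j) \<le> \<Psi> t"
      using admissible_ge_on_dyadic_interval [OF adm] by blast
    define I where "I = (\<integral>\<^sup>+t\<in>{0<..1}. (SUP h\<in>cball 0 t. epowr (Lp_norm (ennreal p) (fin_diff M h g)) r)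
            * ennreal (\<Psi> t powr r / t powr (1 + s * r)) \<partial>lebesgue)"
    let ?\<kappa> = "2 powr (- (1 + s * r))"
    have \<kappa>: "?\<kappa> = 1 / (2 * 2 powr (s * r))" by (simp only: powr_minus_divide powr_add powr_one)
    have ge: "ennreal ((c * R) powr r * ?\<kappa>) \<le> I" if "0 \<le> R" for R
    proof -
      obtain j h where jh: "2 \<le> j" "norm h \<le> (1/2) ^ j"
        "ennreal (R * ((1/2) ^ j) powr s / \<Psi> ((1/2) ^ j)) \<le> Lp_norm (ennreal p) (fin_diff M h g)"
        using big by blast
      let ?d = "(1/2 :: real) ^ j"
      define A where "A = (R * ?d powr s / \<Psi> ?d) powr r * ((c * \<Psi> ?d) powr r / (2 * ?d) powr (1 + s * r))"
      have A: "A * ?d = (c * R) powr r * ?\<kappa>"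
        using half [of j] pos [of j] c(1) \<open>0 \<le> R\<close> unfolding \<kappa>
        by (simp add: A_def powr_mult powr_divide powr_powr powr_add powr_minus field_simps)
      have "ennreal A * indicator {?d..2 * ?d} t
          \<le> (SUP h\<in>cball 0 t. epowr (Lp_norm (ennreal p) (fin_diff M h g)) r)
            * ennreal (\<Psi> t powr r / t powr (1 + s * r)) * indicator {0<..1} t" for t
      proof (cases "t \<in> {?d..2 * ?d}")
        case True
        obtain i where i: "j = Suc i" using jh by (cases j) auto
        have "0 < t" using True half(1) [of j] by (meson atLeastAtMost_iff less_le_trans)
        moreover have "t \<le> 1" using True half(2) [of i] i by simp
        ultimately have t: "0 < t" "t \<le> 1" by blast+
        have "ennreal ((R * ?d powr s / \<Psi> ?d) powr r) \<le> epowr (Lp_norm (ennreal p) (fin_diff M h g)) r"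
          using pos [of j] \<open>0 \<le> R\<close> r jh(3) by (intro epowr_ge) auto
        also have "\<dots> \<le> (SUP h\<in>cball 0 t. epowr (Lp_norm (ennreal p) (fin_diff M h g)) r)"
          by (rule SUP_upper) (use jh True in auto)
        finally have 1: "ennreal ((R * ?d powr s / \<Psi> ?d) powr r) \<le> \<dots>" .
        have "(c * \<Psi> ?d) powr r / (2 * ?d) powr (1 + s * r) \<le> \<Psi> t powr r / t powr (1 + s * r)"
          using c jh True t pos [of j] r s by (intro frac_le powr_mono2) auto
        then have "ennreal ((c * \<Psi> ?d) powr r / (2 * ?d) powr (1 + s * r)) \<le> ennreal (\<Psi> t powr r / t powr (1 + s * r))"
          by (rule ennreal_leI)
        with 1 have "ennreal A \<le> (SUP h\<in>cball 0 t. epowr (Lp_norm (ennreal p) (fin_diff M h g)) r)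
            * ennreal (\<Psi> t powr r / t powr (1 + s * r))"
          unfolding A_def by (subst ennreal_mult) (auto intro!: mult_mono)
        with True t show ?thesis by simp
      qed simp
      then have "(\<integral>\<^sup>+t. ennreal A * indicator {?d..2 * ?d} t \<partial>lebesgue) \<le> I"
        unfolding I_def by (intro nn_integral_mono)
      moreover have "(\<integral>\<^sup>+t. ennreal A * indicator {?d..2 * ?d} t \<partial>lebesgue) = ennreal A * ennreal ?d"
        using half [of j] by (simp add: nn_integral_completion nn_integral_cmult_indicator)
      moreover have "ennreal A * ennreal ?d = ennreal (A * ?d)"
        using half [of j] by (simp add: ennreal_mult'' )
      ultimately show ?thesis using A by simp
    qed
    have "I = \<infinity>"
    proof (rule ennreal_eq_infinityI)
      fix b :: real assume b: "0 \<le> b"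
      let ?R = "(b / ?\<kappa>) powr (1 / r) / c"
      have "(c * ?R) powr r * ?\<kappa> = b"
        using c(1) r b by (simp add: powr_powr)
      then show "ennreal b \<le> I"
        using ge [of ?R] b c(1) by simp
    qed
    then show ?thesis
      using False by (simp add: gen_besov_seminorm_def r_def [symmetric] I_def epowr_def)
  qed
  then show ?thesis by (simp add: gen_besov_space_def)
qed

section \<open>Series of bumps in disjoint slabs\<close>

text \<open>
  Half widths at most $1/2$ and distances $2M + 1$ of the centres in direction \<open>e\<close> keep the supports
  so far apart that the points $z, z + h, \dots, z + Mh$ meet at most one of them if $|h| \le 1$. No side
  of the \<open>j\<close>-th box is shorter than $2^{-j}$ (the entries of \<open>r\<close> are half side lengths).
\<close>

locale bump_series =
  fixes M :: nat and e :: "'a::euclidean_space" and \<alpha> :: "nat \<Rightarrow> real" and c r :: "nat \<Rightarrow> 'a"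
  assumes e: "e \<in> Basis"
    and centre: "\<And>j. c j \<bullet> e = real (2 * M + 1) * real j"
    and radius_e: "\<And>j. r j \<bullet> e \<le> 1 / 2"
    and radius: "\<And>j b. b \<in> Basis \<Longrightarrow> (1/2) ^ Suc j \<le> r j \<bullet> b"
    and amplitude: "\<And>j. 0 \<le> \<alpha> j"
begin

definition series :: "'a \<Rightarrow> real" where
  "series z = (\<Sum>j. \<alpha> j * box_bump (Suc M) (c j) (r j) z)"

lemma radius_pos: "b \<in> Basis \<Longrightarrow> 0 < r j \<bullet> b"
  by (rule less_le_trans [OF _ radius]) simp_all

text \<open>
  The margin $M + 1/2$ allows $M$ steps of length one from any point of the support of the \<open>j\<close>-th bump.
\<close>

lemma series_eq_term:
  assumes "\<bar>(z - c j) \<bullet> e\<bar> \<le> real M + 1 / 2"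
  shows "series z = \<alpha> j * box_bump (Suc M) (c j) (r j) z"
proof -
  have "box_bump (Suc M) (c i) (r i) z = 0" if "i \<noteq> j" for i
  proof (rule box_bump_eq_0 [OF e radius_pos [OF e]])
    have "1 \<le> \<bar>real i - real j\<bar>" using that by (cases i j rule: linorder_cases) auto
    then have "real (2 * M + 1) * 1 \<le> real (2 * M + 1) * \<bar>real i - real j\<bar>"
      by (intro mult_left_mono) auto
    also have "\<dots> = \<bar>(c i - c j) \<bullet> e\<bar>"
      by (simp add: inner_diff_left centre right_diff_distrib [symmetric] abs_mult)
    also have "\<dots> \<le> \<bar>(z - c j) \<bullet> e\<bar> + \<bar>(z - c i) \<bullet> e\<bar>"
      by (simp add: inner_diff_left)
    finally have "real (2 * M + 1) \<le> \<bar>(z - c j) \<bullet> e\<bar> + \<bar>(z - c i) \<bullet> e\<bar>" by simp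
    with assms radius_e [of i] show "r i \<bullet> e \<le> \<bar>(z - c i) \<bullet> e\<bar>" by simp
  qed simp
  then have "series z = (\<Sum>i\<in>{j}. \<alpha> i * box_bump (Suc M) (c i) (r i) z)"
    unfolding series_def by (intro suminf_finite) auto
  then show ?thesis by simp
qed

lemma fin_diff_series_eq_term:
  assumes "norm h \<le> 1" "i \<le> M"
  shows "\<exists>j. fin_diff i h series z = \<alpha> j * fin_diff i h (box_bump (Suc M) (c j) (r j)) z"
proof -
  have he: "\<bar>h \<bullet> e\<bar> \<le> 1" using Basis_le_norm [OF e, of h] assms(1) by linarith
  have "\<exists>j. \<forall>k\<le>i. series (z + real k *\<^sub>R h) = \<alpha> j * box_bump (Suc M) (c j) (r j) (z + real k *\<^sub>R h)"
  proof (cases "\<exists>j. \<exists>k\<le>i. box_bump (Suc M) (c j) (r j) (z + real k *\<^sub>R h) \<noteq> 0")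
    case True
    then obtain j k where jk: "k \<le> i" "box_bump (Suc M) (c j) (r j) (z + real k *\<^sub>R h) \<noteq> 0" by blast
    then have near: "\<bar>(z + real k *\<^sub>R h - c j) \<bullet> e\<bar> < r j \<bullet> e"
      using box_bump_eq_0 [OF e radius_pos [OF e], of j "z + real k *\<^sub>R h" "c j" "Suc M"]
      by linarith
    have "series (z + real l *\<^sub>R h) = \<alpha> j * box_bump (Suc M) (c j) (r j) (z + real l *\<^sub>R h)" if "l \<le> i" for l
    proof (rule series_eq_term)
      have "\<bar>real l - real k\<bar> * \<bar>h \<bullet> e\<bar> \<le> real M * 1"
        using that jk(1) \<open>i \<le> M\<close> he by (intro mult_mono) auto
      then have "\<bar>(real l - real k) * (h \<bullet> e)\<bar> \<le> real M" by (simp add: abs_mult)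
      moreover have "(z + real l *\<^sub>R h - c j) \<bullet> e = (z + real k *\<^sub>R h - c j) \<bullet> e + (real l - real k) * (h \<bullet> e)"
        by (simp add: inner_diff_left inner_add_left left_diff_distrib)
      ultimately show "\<bar>(z + real l *\<^sub>R h - c j) \<bullet> e\<bar> \<le> real M + 1 / 2"
        using near radius_e [of j] by linarith
    qed
    then show ?thesis by blast
  next
    case False
    then show ?thesis by (intro exI [of _ 0]) (simp add: series_def)
  qed
  then obtain j where "\<And>k. k \<le> i \<Longrightarrow> series (z + real k *\<^sub>R h) = \<alpha> j * box_bump (Suc M) (c j) (r j) (z + real k *\<^sub>R h)"
    by blast
  then have "fin_diff i h series z = fin_diff i h (\<lambda>z. \<alpha> j * box_bump (Suc M) (c j) (r j) z) z"
    by (rule fin_diff_cong)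
  then show ?thesis by (auto simp: fin_diff_cmult)
qed

lemma borel_measurable_box_bump: "box_bump n c' r' \<in> borel_measurable borel"
  by (intro borel_measurable_continuous_onI continuous_on_box_bump)

lemma series_measurable: "series \<in> borel_measurable lebesgue"
proof -
  have "series \<in> borel_measurable borel"
    unfolding series_def [abs_def]
    by (intro borel_measurable_suminf borel_measurable_times borel_measurable_const borel_measurable_box_bump)
  then show ?thesis by (simp add: measurable_completion)
qed

text \<open>
  At each point only one summand contributes, so that the sum passes through the \<open>p\<close>-th power even for
  \<open>p < 1\<close>. The factor \<open>\<alpha> j powr p\<close> times the product of the half sides is, up to a constant, the
  \<open>p\<close>-th power of the $L^p$ norm of the \<open>j\<close>-th bump.
\<close>

lemma nn_integral_fin_diff_series_le:
  assumes "0 < p"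
  obtains C where "0 < C" and "\<And>h i. norm h \<le> 1 \<Longrightarrow> i \<le> M \<Longrightarrow>
     (\<integral>\<^sup>+z. ennreal (\<bar>fin_diff i h series z\<bar> powr p) \<partial>lebesgue)
     \<le> (\<Sum>j. ennreal (C * (min 1 (norm h / (1/2) ^ Suc j) ^ i) powr p * (\<alpha> j powr p * (\<Prod>b\<in>Basis. r j \<bullet> b))))"
proof -
  obtain C where C: "0 < C" "\<And>(c::'a::euclidean_space) r h \<delta> i. 0 < \<delta> \<Longrightarrow> (\<And>b. b \<in> Basis \<Longrightarrow> \<delta> \<le> r \<bullet> b) \<Longrightarrow> i \<le> M \<Longrightarrow>
     (\<integral>\<^sup>+z. ennreal (\<bar>fin_diff i h (box_bump (Suc M) c r) z\<bar> powr p) \<partial>lborel)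
     \<le> ennreal (C * (min 1 (norm h / \<delta>) ^ i) powr p * (\<Prod>b\<in>Basis. r \<bullet> b))"
    using nn_integral_fin_diff_box_bump_le [OF assms, where M = M and 'a = 'a] by blast
  have "(\<integral>\<^sup>+z. ennreal (\<bar>fin_diff i h series z\<bar> powr p) \<partial>lebesgue)
     \<le> (\<Sum>j. ennreal (C * (min 1 (norm h / (1/2) ^ Suc j) ^ i) powr p * (\<alpha> j powr p * (\<Prod>b\<in>Basis. r j \<bullet> b))))"
    if h: "norm h \<le> 1" and i: "i \<le> M" for h i
  proof -
    let ?T = "\<lambda>j z. ennreal (\<alpha> j powr p) * ennreal (\<bar>fin_diff i h (box_bump (Suc M) (c j) (r j)) z\<bar> powr p)"
    have "ennreal (\<bar>fin_diff i h series z\<bar> powr p) \<le> (\<Sum>j. ?T j z)" for z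
    proof -
      obtain j where "fin_diff i h series z = \<alpha> j * fin_diff i h (box_bump (Suc M) (c j) (r j)) z"
        using fin_diff_series_eq_term [OF h i] by blast
      then have "ennreal (\<bar>fin_diff i h series z\<bar> powr p) = (\<Sum>j\<in>{j}. ?T j z)"
        using amplitude [of j] by (simp add: abs_mult powr_mult ennreal_mult)
      also have "\<dots> \<le> (\<Sum>j. ?T j z)" by (rule sum_le_suminf) auto
      finally show ?thesis .
    qed
    then have "(\<integral>\<^sup>+z. ennreal (\<bar>fin_diff i h series z\<bar> powr p) \<partial>lebesgue) \<le> (\<integral>\<^sup>+z. (\<Sum>j. ?T j z) \<partial>lborel)"
      unfolding nn_integral_completion by (intro nn_integral_mono)
    also have "\<dots> = (\<Sum>j. \<integral>\<^sup>+z. ?T j z \<partial>lborel)"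
    proof (rule nn_integral_suminf)
      fix j
      have [measurable]: "fin_diff i h (box_bump (Suc M) (c j) (r j)) \<in> borel_measurable borel"
        by (intro borel_measurable_continuous_onI continuous_on_fin_diff continuous_on_box_bump)
      show "?T j \<in> borel_measurable lborel" by measurable
    qed
    also have "\<dots> \<le> (\<Sum>j. ennreal (C * (min 1 (norm h / (1/2) ^ Suc j) ^ i) powr p * (\<alpha> j powr p * (\<Prod>b\<in>Basis. r j \<bullet> b))))"
    proof (rule suminf_le)
      fix j
      have [measurable]: "fin_diff i h (box_bump (Suc M) (c j) (r j)) \<in> borel_measurable borel"
        by (intro borel_measurable_continuous_onI continuous_on_fin_diff continuous_on_box_bump)
      have "(\<integral>\<^sup>+z. ?T j z \<partial>lborel)
          = ennreal (\<alpha> j powr p) * (\<integral>\<^sup>+z. ennreal (\<bar>fin_diff i h (box_bump (Suc M) (c j) (r j)) z\<bar> powr p) \<partial>lborel)"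
        by (rule nn_integral_cmult) measurable
      also have "\<dots> \<le> ennreal (\<alpha> j powr p) * ennreal (C * (min 1 (norm h / (1/2) ^ Suc j) ^ i) powr p * (\<Prod>b\<in>Basis. r j \<bullet> b))"
        by (intro mult_left_mono C(2) radius i) auto
      also have "\<dots> = ennreal (C * (min 1 (norm h / (1/2) ^ Suc j) ^ i) powr p * (\<alpha> j powr p * (\<Prod>b\<in>Basis. r j \<bullet> b)))"
        by (simp add: ennreal_mult' [symmetric] mult_ac)
      finally show "(\<integral>\<^sup>+z. ?T j z \<partial>lborel)
          \<le> ennreal (C * (min 1 (norm h / (1/2) ^ Suc j) ^ i) powr p * (\<alpha> j powr p * (\<Prod>b\<in>Basis. r j \<bullet> b)))" .
    qed auto
    finally show ?thesis .
  qed
  with C(1) show thesis by (rule that)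
qed

end

lemma prod_Basis_prod:
  "(\<Prod>b\<in>(Basis :: ('a::euclidean_space \<times> 'b::euclidean_space) set). (u, v) \<bullet> b)
    = (\<Prod>b\<in>Basis. u \<bullet> b) * (\<Prod>b\<in>Basis. v \<bullet> b)"
proof -
  have "(\<Prod>b\<in>(Basis :: ('a \<times> 'b) set). (u, v) \<bullet> b)
      = (\<Prod>b\<in>(\<lambda>a. (a, 0)) ` Basis. (u, v) \<bullet> b) * (\<Prod>b\<in>(\<lambda>b. (0, b)) ` Basis. (u, v) \<bullet> b)"
    unfolding Basis_prod_def by (rule prod.union_disjoint) (auto dest: nonzero_Basis)
  also have "(\<Prod>b\<in>(\<lambda>a. (a, 0)) ` (Basis :: 'a set). (u, v) \<bullet> b) = (\<Prod>b\<in>Basis. u \<bullet> b)"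
    by (subst prod.reindex) (auto simp: inj_on_def)
  also have "(\<Prod>b\<in>(\<lambda>b. (0, b)) ` (Basis :: 'b set). (u, v) \<bullet> b) = (\<Prod>b\<in>Basis. v \<bullet> b)"
    by (subst prod.reindex) (auto simp: inj_on_def)
  finally show ?thesis .
qed

text \<open>
  If \<open>y\<close> is in the inner half of the \<open>j\<close>-th box, then on the inner half of its $x$-section the bump is
  bounded from below, while one step of length $2^{-j}$, the full width of the section in direction \<open>e\<close>,
  leads outside of the support.
\<close>

lemma Lp_norm_fin_diff_slice_ge:
  fixes e :: "'a::euclidean_space" and c r :: "nat \<Rightarrow> 'a \<times> 'b::euclidean_space"
  assumes series: "bump_series M (e, 0) \<alpha> c r" and "e \<in> Basis" "1 \<le> M" "0 < p"
    and r: "fst (r j) = (1/2) ^ Suc j *\<^sub>R One"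
    and y: "\<And>b. b \<in> Basis \<Longrightarrow> \<bar>(y - snd (c j)) \<bullet> b\<bar> \<le> snd (r j) \<bullet> b / 2"
  shows "ennreal (\<alpha> j * ((3 / 4) ^ Suc M) ^ DIM('a \<times> 'b) * ((1/2) ^ Suc j) powr (DIM('a) / p))
    \<le> Lp_norm (ennreal p) (fin_diff M ((1/2) ^ j *\<^sub>R e) (\<lambda>x. bump_series.series M \<alpha> c r (x, y)))"
proof -
  interpret bump_series M "(e, 0)" \<alpha> c r by (rule series)
  define \<delta> where "\<delta> = (1/2 :: real) ^ j"
  have \<delta>: "0 < \<delta>" "\<delta> \<le> 1" by (simp_all add: \<delta>_def power_le_one)
  define \<kappa> where "\<kappa> = ((3 / 4 :: real) ^ Suc M) ^ DIM('a \<times> 'b)"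
  have "0 < \<kappa>" by (simp add: \<kappa>_def)
  let ?g = "\<lambda>x. series (x, y)" and ?h = "(1/2) ^ j *\<^sub>R e"
  let ?A = "cbox (fst (c j) - (\<delta> / 4) *\<^sub>R One) (fst (c j) + (\<delta> / 4) *\<^sub>R One)"
  have rb: "fst (r j) \<bullet> b = \<delta> / 2" if "b \<in> Basis" for b
    using that by (simp add: r \<delta>_def)
  have ge: "\<alpha> j * \<kappa> \<le> \<bar>fin_diff M ?h ?g x\<bar>" if "x \<in> ?A" for x
  proof -
    have x: "\<bar>(x - fst (c j)) \<bullet> b\<bar> \<le> \<delta> / 4" if "b \<in> Basis" for b
    proof -
      have "(fst (c j) - (\<delta> / 4) *\<^sub>R One) \<bullet> b \<le> x \<bullet> b \<and> x \<bullet> b \<le> (fst (c j) + (\<delta> / 4) *\<^sub>R One) \<bullet> b"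
        using \<open>x \<in> ?A\<close> that by (simp only: mem_box)
      then have "fst (c j) \<bullet> b - \<delta> / 4 \<le> x \<bullet> b" "x \<bullet> b \<le> fst (c j) \<bullet> b + \<delta> / 4"
        using that by (simp_all add: inner_diff_left inner_add_left)
      then show ?thesis unfolding inner_diff_left by linarith
    qed
    have local_eq: "series (x + real k *\<^sub>R ?h, y) = \<alpha> j * box_bump (Suc M) (c j) (r j) (x + real k *\<^sub>R ?h, y)"
      if "k \<le> M" for k
    proof (rule series_eq_term)
      have "((x + real k *\<^sub>R ?h, y) - c j) \<bullet> (e, 0) = (x - fst (c j)) \<bullet> e + real k * \<delta>"
        using \<open>e \<in> Basis\<close> by (cases "c j") (simp add: \<delta>_def inner_diff_left inner_add_left)
      moreover have "0 \<le> real k * \<delta>" using \<delta> by simp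
      moreover have "real k * \<delta> \<le> real M * 1" using that \<delta> by (intro mult_mono) auto
      ultimately show "\<bar>((x + real k *\<^sub>R ?h, y) - c j) \<bullet> (e, 0)\<bar> \<le> real M + 1 / 2"
        using x [OF \<open>e \<in> Basis\<close>] \<delta> by linarith
    qed
    have "?g (x + real k *\<^sub>R ?h) = 0" if k: "1 \<le> k" "k \<le> M" for k
    proof -
      have "((x + real k *\<^sub>R ?h, y) - c j) \<bullet> (e, 0) = (x - fst (c j)) \<bullet> e + real k * \<delta>"
        using \<open>e \<in> Basis\<close> by (cases "c j") (simp add: \<delta>_def inner_diff_left inner_add_left)
      moreover have "1 * \<delta> \<le> real k * \<delta>" using k(1) \<delta> by (intro mult_right_mono) auto
      moreover have "r j \<bullet> (e, 0) = \<delta> / 2"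
        using rb [OF \<open>e \<in> Basis\<close>] by (cases "r j") simp
      ultimately have "r j \<bullet> (e, 0) \<le> \<bar>((x + real k *\<^sub>R ?h, y) - c j) \<bullet> (e, 0)\<bar>"
        using x [OF \<open>e \<in> Basis\<close>] \<delta> by linarith
      then have "box_bump (Suc M) (c j) (r j) (x + real k *\<^sub>R ?h, y) = 0"
        by (intro box_bump_eq_0 [OF e radius_pos [OF e]]) auto
      then show ?thesis using local_eq [OF k(2)] by simp
    qed
    then have "\<bar>fin_diff M ?h ?g x\<bar> = \<bar>?g x\<bar>" by (rule fin_diff_isolated)
    also have "?g x = \<alpha> j * box_bump (Suc M) (c j) (r j) (x, y)" using local_eq [of 0] by simp
    also have "\<bar>\<dots>\<bar> = \<dots>" using amplitude [of j] box_bump_nonneg [of "Suc M" "c j" "r j"] by simp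
    also have "\<dots> \<ge> \<alpha> j * \<kappa>" unfolding \<kappa>_def
    proof (intro mult_left_mono amplitude box_bump_ge conjI)
      fix b :: "'a \<times> 'b" assume b: "b \<in> Basis"
      then show "0 < r j \<bullet> b" by (rule radius_pos)
      from b consider u where "u \<in> Basis" "b = (u, 0)" | v where "v \<in> Basis" "b = (0, v)"
        by (auto simp: Basis_prod_def)
      then show "\<bar>((x, y) - c j) \<bullet> b\<bar> \<le> r j \<bullet> b / 2"
      proof cases
        case (1 u)
        then show ?thesis
          using x [OF 1(1)] rb [OF 1(1)] by (cases "c j"; cases "r j") simp
      next
        case (2 v)
        then show ?thesis using y [OF 2(1)] by (cases "c j"; cases "r j") simp
      qed
    qed
    finally show ?thesis .
  qed
  have vol: "emeasure lborel ?A = ennreal ((\<delta> / 2) ^ DIM('a))"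
  proof -
    have "emeasure lborel ?A = ennreal (\<Prod>b\<in>(Basis::'a set). (fst (c j) + (\<delta> / 4) *\<^sub>R One - (fst (c j) - (\<delta> / 4) *\<^sub>R One)) \<bullet> b)"
      using \<delta> by (intro emeasure_lborel_cbox) (auto simp: inner_diff_left inner_add_left)
    also have "(\<Prod>b\<in>(Basis::'a set). (fst (c j) + (\<delta> / 4) *\<^sub>R One - (fst (c j) - (\<delta> / 4) *\<^sub>R One)) \<bullet> b) = (\<Prod>b\<in>(Basis::'a set). \<delta> / 2)"
      by (rule prod.cong) (auto simp: inner_diff_left inner_add_left)
    finally show ?thesis by simp
  qed
  have nn: "0 \<le> \<alpha> j * \<kappa>" using amplitude [of j] \<open>0 < \<kappa>\<close> by simp
  have "ennreal ((\<alpha> j * \<kappa>) powr p * (\<delta> / 2) ^ DIM('a)) = ennreal ((\<alpha> j * \<kappa>) powr p) * emeasure lborel ?A"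
    unfolding vol using \<delta> by (intro ennreal_mult) auto
  also have "\<dots> = (\<integral>\<^sup>+x. ennreal ((\<alpha> j * \<kappa>) powr p) * indicator ?A x \<partial>lborel)"
    by (intro nn_integral_cmult_indicator [symmetric]) simp
  also have "\<dots> \<le> (\<integral>\<^sup>+x. ennreal (\<bar>fin_diff M ?h ?g x\<bar> powr p) \<partial>lborel)"
    using ge nn \<open>0 < p\<close> by (intro nn_integral_mono) (auto simp: indicator_def intro!: ennreal_leI powr_mono2)
  also have "\<dots> = (\<integral>\<^sup>+x. ennreal (\<bar>fin_diff M ?h ?g x\<bar> powr p) \<partial>lebesgue)"
    by (rule nn_integral_completion [symmetric])
  finally have "ennreal (((\<alpha> j * \<kappa>) powr p * (\<delta> / 2) ^ DIM('a)) powr (1 / p)) \<le> Lp_norm (ennreal p) (fin_diff M ?h ?g)"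
    using \<open>0 < p\<close> \<delta> by (intro Lp_norm_ge) auto
  also have "((\<alpha> j * \<kappa>) powr p * (\<delta> / 2) ^ DIM('a)) powr (1 / p) = \<alpha> j * \<kappa> * (\<delta> / 2) powr (DIM('a) / p)"
  proof -
    have "(\<delta> / 2) ^ DIM('a) = (\<delta> / 2) powr DIM('a)" using \<delta> by (simp add: powr_realpow)
    then have "(X powr p * (\<delta> / 2) ^ DIM('a)) powr (1 / p) = X * (\<delta> / 2) powr (DIM('a) / p)"
      if "0 \<le> X" for X
      using that \<open>0 < p\<close> by (simp only: powr_mult powr_powr) simp
    then show ?thesis using nn by blast
  qed
  finally show ?thesis by (simp add: \<kappa>_def \<delta>_def)
qed

section \<open>Besov functions with rough slices\<close>

text \<open>
  For $q < \infty$ and $r = q/p$ the exponent \<open>chi p q / p\<close> is the dual exponent $r' = r/(r-1)$; for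
  $q = \infty$ it is $1$. Here \<open>a\<close> stands for the sequence $\Psi(2^{-j})^p$.
\<close>

lemma exists_weights:
  fixes a :: "nat \<Rightarrow> real"
  assumes a: "\<And>j. 0 < a j" and p: "0 < p" "ennreal p < q"
    and div: "\<not> summable (\<lambda>j. (a j) powr (chi p q / p))"
  shows "\<exists>m B \<omega>. (\<forall>j. 0 \<le> m j \<and> m j \<le> B \<and> 1 \<le> \<omega> j) \<and> filterlim \<omega> at_top sequentially
    \<and> (q < \<infinity> \<longrightarrow> summable (\<lambda>j. m j powr (enn2real q / p))) \<and> \<not> summable (\<lambda>j. a j * m j / \<omega> j)"
proof (cases "q = \<infinity>")
  case True
  then have "\<not> summable a" using div p a by (simp add: chi_def less_imp_le)
  then obtain \<omega> where "\<forall>j. 1 \<le> \<omega> j" "filterlim \<omega> at_top sequentially" "\<not> summable (\<lambda>j. a j / \<omega> j)"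
    using exists_dual_sequence_bounded [of a] a by blast
  then show ?thesis using True by (intro exI [of _ "\<lambda>_. 1"] exI [of _ 1] exI [of _ \<omega>]) auto
next
  case False
  then have qfin: "q < \<infinity>" by (simp add: top.not_eq_extremum)
  define r where "r = enn2real q / p"
  have r: "1 < r" using finite_exponent(2) [OF p qfin] p by (simp add: r_def)
  have "chi p q / p = r / (r - 1)"
    using False finite_exponent(2) [OF p qfin] p by (simp add: chi_def r_def field_simps)
  then obtain m \<omega> where m: "\<forall>j. 0 \<le> m j" "\<forall>j. 1 \<le> \<omega> j" "filterlim \<omega> at_top sequentially"
     "summable (\<lambda>j. m j powr r)" "\<not> summable (\<lambda>j. a j * m j / \<omega> j)"
    using exists_dual_sequence_powr [of a r] a r div by auto
  have "m j \<le> (\<Sum>j. m j powr r) powr (1 / r)" for j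
  proof -
    have "m j powr r \<le> (\<Sum>j. m j powr r)"
      using sum_le_suminf [OF m(4), of "{j}"] by simp
    then have "(m j powr r) powr (1 / r) \<le> (\<Sum>j. m j powr r) powr (1 / r)"
      using r by (intro powr_mono2) auto
    then show ?thesis using m(1) r by (simp add: powr_powr)
  qed
  with m show ?thesis
    by (intro exI [of _ m] exI [of _ "(\<Sum>j. m j powr r) powr (1 / r)"] exI [of _ \<omega>]) (auto simp: r_def)
qed

text \<open>
  Every slice is rough, and not just almost every one, because the path visits every point of the line
  and the other sides of the boxes exhaust the space.
\<close>

theorem exists_besov_function_with_rough_slices:
  fixes p s :: real and q :: ennreal and \<Psi> :: "real \<Rightarrow> real"
  assumes p: "0 < p" "ennreal p < q" and s: "0 < s" "s < real M"
    and adm: "admissible \<Psi>"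
    and div: "(\<Sum>j. ennreal (\<Psi> ((1/2) ^ j) powr chi p q)) = \<infinity>"
  shows "\<exists>f \<in> (besov_space M s (ennreal p) q :: ('a::euclidean_space \<times> 'b::euclidean_space \<Rightarrow> real) set).
           \<forall>y. (\<lambda>x. f (x, y)) \<notin> gen_besov_space M s \<Psi> (ennreal p) q"
proof -
  let ?d = "DIM('a)" and ?m = "DIM('b)"
  have half: "0 < (1/2 :: real) ^ n" "(1/2 :: real) ^ n \<le> 1" for n by (simp_all add: power_le_one)
  have \<Psi>: "0 < \<Psi> ((1/2) ^ j)" for j using admissible_pos [OF adm] half by blast
  have "1 \<le> M" using s by linarith
  define a where "a j = \<Psi> ((1/2) ^ j) powr p" for j
  have a: "0 < a j" for j using \<Psi> [of j] by (simp add: a_def)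
  have a_powr: "a j powr (chi p q / p) = \<Psi> ((1/2) ^ j) powr chi p q" for j
    using p by (simp add: a_def powr_powr)
  have ns0: "\<not> summable (\<lambda>j. a j powr (chi p q / p))"
  proof
    assume "summable (\<lambda>j. a j powr (chi p q / p))"
    then have "(\<Sum>j. ennreal (\<Psi> ((1/2) ^ j) powr chi p q)) < \<infinity>"
      by (subst suminf_ennreal2) (auto simp: a_powr)
    with div show False by simp
  qed
  obtain m B \<omega> where weights: "\<forall>j. 0 \<le> m j \<and> m j \<le> B \<and> 1 \<le> \<omega> j"
    and \<omega>_lim: "filterlim \<omega> at_top sequentially"
    and m_lr: "q < \<infinity> \<longrightarrow> summable (\<lambda>j. m j powr (enn2real q / p))"
    and ns: "\<not> summable (\<lambda>j. a j * m j / \<omega> j)"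
    using exists_weights [OF a p ns0] by (elim exE conjE)
  have m: "0 \<le> m j" "m j \<le> B" and \<omega>: "1 \<le> \<omega> j" for j using weights by auto
  define \<tau> where "\<tau> j = a j * m j / \<omega> j" for j
  have \<tau>: "0 \<le> \<tau> j" for j using a [of j] m(1) [of j] \<omega> [of j] by (simp add: \<tau>_def)
  define \<rho> where "\<rho> j = (if (1/2) ^ j \<le> \<tau> j then \<tau> j else 0)" for j
  have \<rho>: "0 \<le> \<rho> j" "\<rho> j \<le> \<tau> j" for j using \<tau> by (auto simp: \<rho>_def)
  have \<rho>_div: "\<not> summable \<rho>"
    unfolding \<rho>_def [abs_def] by (rule not_summable_truncate) (use \<tau> ns in \<open>auto simp: \<tau>_def [abs_def]\<close>)
  have \<rho>_ge: "(1/2) ^ j \<le> \<rho> j" if "0 < \<rho> j" for j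
    using that by (auto simp: \<rho>_def split: if_splits)
  \<comment> \<open>The side lengths in the remaining directions of $y$: they tend to infinity, but their product is
      at most $\sqrt{\omega_j}$.\<close>
  define L where "L j = \<omega> j powr (1 / (2 * real ?m))" for j
  have L: "1 \<le> L j" for j using \<omega> by (simp add: L_def ge_one_powr_ge_zero)
  have L_power: "L j ^ (?m - 1) \<le> sqrt (\<omega> j)" for j
  proof -
    have "L j ^ (?m - 1) = \<omega> j powr (1 / (2 * real ?m) * real (?m - 1))"
      using \<omega> [of j] by (simp add: L_def powr_power)
    also have "\<dots> \<le> \<omega> j powr (1 / 2)"
      using \<omega> [of j] DIM_positive [where 'a = 'b] by (intro powr_mono) (auto simp: field_simps of_nat_diff)
    finally show ?thesis using \<omega> [of j] by (simp add: powr_half_sqrt)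
  qed
  obtain e :: 'a where e_in: "e \<in> Basis" using nonempty_Basis by blast
  obtain e' :: 'b where e': "e' \<in> Basis" using nonempty_Basis by blast
  \<comment> \<open>The amplitude $2^{-js} 2^{jd/p} \lambda_j$ with $\lambda_j^p = \sqrt{\omega_j} / a_j$: the factor
      $2^{jd/p}$ normalises the bump in $x$. One of the two factors $\sqrt{\omega_j}$ in $\omega_j$ is
      spent on $\lambda_j$ and makes $\lambda_j \Psi(2^{-j})$ unbounded, the other one pays for \<open>L\<close>.\<close>
  define \<alpha> where "\<alpha> j = (if 0 < \<rho> j
      then ((1/2) ^ j) powr (s - real ?d / p) * (sqrt (\<omega> j) / a j) powr (1 / p) else 0)" for j
  define c where "c j = ((real (2 * M + 1) * real j) *\<^sub>R e, walk (\<Sum>i<j. \<rho> i) *\<^sub>R e')" for j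
  \<comment> \<open>The maximum only matters for the dropped indices, where the amplitude is zero but the box must
      still be non-degenerate. The factor $2$ provides for the inner half of the box.\<close>
  define ry where "ry j = (\<Sum>b\<in>Basis. (if b = e' then 2 * max (\<rho> j) ((1/2) ^ j) else 2 * L j) *\<^sub>R b)" for j
  define r where "r j = ((1/2) ^ Suc j *\<^sub>R (One :: 'a), ry j)" for j
  have ry: "ry j \<bullet> b = (if b = e' then 2 * max (\<rho> j) ((1/2) ^ j) else 2 * L j)" if "b \<in> Basis" for j b
    using that by (simp add: ry_def)
  have series: "bump_series M (e, 0) \<alpha> c r"
  proof
    show "(e, 0) \<in> Basis" using e_in by (simp add: Basis_prod_def)
    show "c j \<bullet> (e, 0) = real (2 * M + 1) * real j" for j using e_in by (simp add: c_def)
    show "r j \<bullet> (e, 0) \<le> 1 / 2" for j using e_in half(2) [of j] by (simp add: r_def)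
    show "(1/2) ^ Suc j \<le> r j \<bullet> b" if "b \<in> Basis" for j b
    proof -
      have "(1/2) ^ Suc j \<le> ry j \<bullet> b" if "b \<in> Basis" for b
      proof -
        have "(1/2 :: real) ^ Suc j = (1/2) ^ j / 2" "(1/2) ^ j \<le> max (\<rho> j) ((1/2) ^ j)" by simp_all
        moreover have "ry j \<bullet> b = 2 * max (\<rho> j) ((1/2) ^ j) \<or> ry j \<bullet> b = 2 * L j"
          using ry [OF that] by simp
        ultimately show ?thesis using half [of j] L [of j] by linarith
      qed
      with that show ?thesis by (auto simp: Basis_prod_def r_def)
    qed
    show "0 \<le> \<alpha> j" for j using a [of j] \<omega> [of j] by (simp add: \<alpha>_def)
  qed
  interpret bump_series M "(e, 0)" \<alpha> c r by (rule series)
  \<comment> \<open>This is $\lambda_j^p |E_j| \lesssim m_j$, multiplied by $2^{-jsp}$.\<close>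
  have mass: "\<alpha> j powr p * (\<Prod>b\<in>Basis. r j \<bullet> b) \<le> 2 ^ ?m * (((1/2) ^ j) powr (s * p) * m j)" for j
  proof (cases "0 < \<rho> j")
    case True
    define \<delta> where "\<delta> = (1/2 :: real) ^ j"
    have \<delta>: "0 < \<delta>" by (simp add: \<delta>_def)
    have "(\<Prod>b\<in>(Basis :: 'b set). ry j \<bullet> b) = 2 * \<rho> j * (2 * L j) ^ (?m - 1)"
    proof -
      have "(\<Prod>b\<in>(Basis :: 'b set). ry j \<bullet> b) = ry j \<bullet> e' * (\<Prod>b\<in>Basis - {e'}. ry j \<bullet> b)"
        using e' by (intro prod.remove) auto
      also have "(\<Prod>b\<in>Basis - {e'}. ry j \<bullet> b) = (\<Prod>b\<in>Basis - {e'}. 2 * L j)"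
        by (rule prod.cong) (auto simp: ry)
      finally show ?thesis using e' \<rho>_ge [OF True] by (simp add: ry card_Diff_singleton)
    qed
    also have "\<dots> = 2 ^ ?m * (\<rho> j * L j ^ (?m - 1))"
      using DIM_positive [where 'a = 'b] by (cases ?m) (auto simp: power_mult_distrib)
    also have "\<dots> \<le> 2 ^ ?m * (\<tau> j * sqrt (\<omega> j))"
      using L [of j] \<rho> \<tau> by (intro mult_left_mono mult_mono L_power) auto
    finally have ry_le: "(\<Prod>b\<in>(Basis :: 'b set). ry j \<bullet> b) \<le> 2 ^ ?m * (\<tau> j * sqrt (\<omega> j))" .
    have "(\<Prod>b\<in>Basis. r j \<bullet> b) = (\<delta> / 2) ^ ?d * (\<Prod>b\<in>(Basis :: 'b set). ry j \<bullet> b)"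
      by (simp add: r_def prod_Basis_prod \<delta>_def)
    also have "\<dots> \<le> \<delta> ^ ?d * (2 ^ ?m * (\<tau> j * sqrt (\<omega> j)))"
    proof (intro mult_mono ry_le power_mono)
      show "0 \<le> (\<Prod>b\<in>(Basis :: 'b set). ry j \<bullet> b)"
        using L [of j] \<rho> by (intro prod_nonneg) (auto simp: ry max_def)
    qed (use \<delta> in auto)
    finally have r_le: "(\<Prod>b\<in>Basis. r j \<bullet> b) \<le> \<delta> ^ ?d * (2 ^ ?m * (\<tau> j * sqrt (\<omega> j)))" .
    have "\<alpha> j powr p = \<delta> powr (s * p - real ?d) * (sqrt (\<omega> j) / a j)"
      using True p a [of j] \<omega> [of j]
      by (simp add: \<alpha>_def \<delta>_def powr_mult powr_powr left_diff_distrib)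
    then have "\<alpha> j powr p * (\<Prod>b\<in>Basis. r j \<bullet> b)
        \<le> \<delta> powr (s * p - real ?d) * (sqrt (\<omega> j) / a j) * (\<delta> ^ ?d * (2 ^ ?m * (\<tau> j * sqrt (\<omega> j))))"
      using a [of j] \<omega> [of j] r_le by (simp only:) (intro mult_left_mono, auto)
    also have "\<dots> = 2 ^ ?m * ((\<delta> powr (s * p - real ?d) * \<delta> ^ ?d) * (sqrt (\<omega> j) * sqrt (\<omega> j) / a j * \<tau> j))"
      by simp
    also have "\<delta> powr (s * p - real ?d) * \<delta> ^ ?d = \<delta> powr (s * p)"
      using \<delta> by (simp add: powr_diff powr_realpow)
    also have "sqrt (\<omega> j) * sqrt (\<omega> j) / a j * \<tau> j = m j"
      using a [of j] \<omega> [of j] by (simp add: \<tau>_def)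
    finally show ?thesis by (simp add: \<delta>_def)
  next
    case False
    then show ?thesis using m(1) [of j] by (simp add: \<alpha>_def)
  qed
  obtain C where C: "0 < C" "\<And>h i. norm h \<le> 1 \<Longrightarrow> i \<le> M \<Longrightarrow>
     (\<integral>\<^sup>+z. ennreal (\<bar>fin_diff i h series z\<bar> powr p) \<partial>lebesgue)
     \<le> (\<Sum>j. ennreal (C * (min 1 (norm h / (1/2) ^ Suc j) ^ i) powr p * (\<alpha> j powr p * (\<Prod>b\<in>Basis. r j \<bullet> b))))"
    using nn_integral_fin_diff_series_le [OF p(1)] by blast
  have diff: "(\<integral>\<^sup>+z. ennreal (\<bar>fin_diff i h series z\<bar> powr p) \<partial>lebesgue)
     \<le> (\<Sum>j. ennreal (C * 2 ^ ?m * (min 1 (norm h / (1/2) ^ Suc j) ^ i) powr p * ((1/2) ^ j) powr (s * p) * m j))"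
    if "norm h \<le> 1" "i \<le> M" for h i
  proof (rule order_trans [OF C(2) [OF that]], rule suminf_le)
    fix j
    let ?x = "(min 1 (norm h / (1/2) ^ Suc j) ^ i) powr p"
    have "C * ?x * (\<alpha> j powr p * (\<Prod>b\<in>Basis. r j \<bullet> b)) \<le> C * ?x * (2 ^ ?m * (((1/2) ^ j) powr (s * p) * m j))"
      using C(1) by (intro mult_left_mono mass) auto
    then show "ennreal (C * ?x * (\<alpha> j powr p * (\<Prod>b\<in>Basis. r j \<bullet> b)))
        \<le> ennreal (C * 2 ^ ?m * ?x * ((1/2) ^ j) powr (s * p) * m j)"
      by (intro ennreal_leI) (simp only: mult_ac)
  qed auto
  have "series \<in> Lp_space (ennreal p)"
  proof -
    define \<theta> where "\<theta> = (1/2 :: real) powr (s * p)"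
    have \<theta>: "0 < \<theta>" "\<theta> < 1"
      using p s powr_less_mono' [of "1/2" 0 "s * p"] by (auto simp: \<theta>_def)
    have "(\<integral>\<^sup>+z. ennreal (\<bar>series z\<bar> powr p) \<partial>lebesgue)
        \<le> (\<Sum>j. ennreal (C * 2 ^ ?m * ((1/2) ^ j) powr (s * p) * m j))"
      using diff [of 0 0] by simp
    also have "\<dots> \<le> (\<Sum>j. ennreal (C * 2 ^ ?m * B * \<theta> ^ j))"
    proof (rule suminf_le)
      fix j
      have "((1/2) ^ j) powr (s * p) = \<theta> ^ j"
        by (simp add: \<theta>_def powr_power powr_realpow [symmetric] powr_powr mult.commute)
      moreover have "C * 2 ^ ?m * \<theta> ^ j * m j \<le> C * 2 ^ ?m * \<theta> ^ j * B"
        using C(1) \<theta> m(2) by (intro mult_left_mono) auto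
      ultimately show "ennreal (C * 2 ^ ?m * ((1/2) ^ j) powr (s * p) * m j) \<le> ennreal (C * 2 ^ ?m * B * \<theta> ^ j)"
        by (intro ennreal_leI) (simp add: mult_ac)
    qed auto
    also have "\<dots> < \<infinity>"
    proof -
      have "0 \<le> B" using m(1,2) [of 0] by linarith
      moreover have "summable (\<lambda>j. C * 2 ^ ?m * B * \<theta> ^ j)"
        using \<theta> by (intro summable_mult summable_geometric) auto
      ultimately show ?thesis using C(1) \<theta> by (subst suminf_ennreal2) auto
    qed
    finally have "(\<integral>\<^sup>+z. ennreal (\<bar>series z\<bar> powr p) \<partial>lebesgue) < \<infinity>" .
    then show ?thesis using series_measurable p by (simp add: Lp_space_def Lp_norm_def epowr_def)
  qed
  then have in_space: "series \<in> besov_space M s (ennreal p) q"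
  proof (rule besov_space_dyadicI [OF _ p s m(1)])
    show "\<forall>j. m j \<le> B" using m(2) by blast
    show "0 \<le> C * 2 ^ ?m" using C(1) by simp
    fix h :: "'a \<times> 'b" assume h: "h \<noteq> 0" "norm h \<le> 1"
    have "(min 1 (norm h / (1/2) ^ Suc j) ^ M) powr p = min 1 (norm h / (1/2) ^ Suc j) powr (real M * p)" for j
    proof -
      have "0 < min 1 (norm h / (1/2) ^ Suc j)" using h by simp
      then show ?thesis by (simp only: powr_realpow [symmetric] powr_powr)
    qed
    then show "(\<integral>\<^sup>+x. ennreal (\<bar>fin_diff M h series x\<bar> powr p) \<partial>lebesgue)
      \<le> (\<Sum>j. ennreal (C * 2 ^ ?m * min 1 (norm h / (1/2) ^ Suc j) powr (real M * p) * ((1/2) ^ j) powr (s * p) * m j))"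
      using diff [OF h(2), of M] by simp
  qed (use m_lr in auto)
  have "(\<lambda>x. series (x, y)) \<notin> gen_besov_space M s \<Psi> (ennreal p) q" for y
  proof (rule not_in_gen_besov_spaceI [OF adm p s(1)])
    fix R :: real
    define \<kappa> where "\<kappa> = ((3 / 4 :: real) ^ Suc M) ^ DIM('a \<times> 'b) * (1/2) powr (real ?d / p)"
    have \<kappa>: "0 < \<kappa>" by (simp add: \<kappa>_def)
    have "filterlim L at_top sequentially"
      unfolding L_def [abs_def] by (rule filterlim_compose [OF real_powr_at_top \<omega>_lim]) simp
    then have "\<forall>\<^sub>F j in sequentially. norm y \<le> L j" by (simp add: filterlim_at_top)
    moreover have "filterlim (\<lambda>j. \<omega> j powr (1 / (2 * p))) at_top sequentially"
      by (rule filterlim_compose [OF real_powr_at_top \<omega>_lim]) (use p in simp)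
    then have "\<forall>\<^sub>F j in sequentially. R / \<kappa> \<le> \<omega> j powr (1 / (2 * p))" by (simp add: filterlim_at_top)
    ultimately have "\<forall>\<^sub>F j in sequentially. norm y \<le> L j \<and> R / \<kappa> \<le> \<omega> j powr (1 / (2 * p))"
      by (rule eventually_conj)
    then obtain N where N: "\<And>j. N \<le> j \<Longrightarrow> norm y \<le> L j" "\<And>j. N \<le> j \<Longrightarrow> R / \<kappa> \<le> \<omega> j powr (1 / (2 * p))"
      unfolding eventually_sequentially by blast
    obtain j where j: "max 2 N \<le> j" "0 < \<rho> j" "\<bar>y \<bullet> e' - walk (\<Sum>i<j. \<rho> i)\<bar> \<le> \<rho> j"
      using walk_visits_infinitely_often [of \<rho> "max 2 N" "y \<bullet> e'"] \<rho>(1) \<rho>_div by blast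
    define \<delta> where "\<delta> = (1/2 :: real) ^ j"
    have \<delta>: "0 < \<delta>" by (simp add: \<delta>_def)
    have near: "\<bar>(y - snd (c j)) \<bullet> b\<bar> \<le> snd (r j) \<bullet> b / 2" if b: "b \<in> Basis" for b
    proof (cases "b = e'")
      case True
      then show ?thesis using j e' by (simp add: c_def r_def ry inner_diff_left)
    next
      case False
      then have "e' \<bullet> b = 0" using b e' by (simp add: inner_not_same_Basis)
      moreover have "\<bar>y \<bullet> b\<bar> \<le> L j" using Basis_le_norm [OF b, of y] N(1) [of j] j(1) by simp
      ultimately show ?thesis using False b by (simp add: c_def r_def ry inner_diff_left)
    qed
    have "\<alpha> j * ((3 / 4) ^ Suc M) ^ DIM('a \<times> 'b) * ((1/2) ^ Suc j) powr (real ?d / p)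
        = \<kappa> * \<omega> j powr (1 / (2 * p)) * \<delta> powr s / \<Psi> \<delta>"
    proof -
      have "(sqrt (\<omega> j) / a j) powr (1 / p) = \<omega> j powr (1 / (2 * p)) / \<Psi> \<delta>"
        using \<omega> [of j] \<Psi> [of j] p
        by (simp add: powr_half_sqrt [symmetric] powr_divide powr_powr a_def \<delta>_def)
      moreover have "\<delta> powr (s - real ?d / p) * ((1/2) ^ Suc j) powr (real ?d / p) = (1/2) powr (real ?d / p) * \<delta> powr s"
      proof -
        have "((1/2) ^ Suc j) powr (real ?d / p) = (1/2) powr (real ?d / p) * \<delta> powr (real ?d / p)"
          by (simp only: power_Suc \<delta>_def powr_mult)
        then show ?thesis using \<delta> by (simp add: powr_diff)
      qed
      ultimately show ?thesis using j(2) by (simp add: \<alpha>_def \<delta>_def [symmetric] \<kappa>_def mult_ac)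
    qed
    moreover have "R * \<delta> powr s / \<Psi> \<delta> \<le> \<kappa> * \<omega> j powr (1 / (2 * p)) * \<delta> powr s / \<Psi> \<delta>"
    proof -
      have "R \<le> \<kappa> * \<omega> j powr (1 / (2 * p))" using N(2) [of j] j(1) \<kappa> by (simp add: field_simps)
      then show ?thesis using \<Psi> [of j] by (intro divide_right_mono mult_right_mono) (auto simp: \<delta>_def)
    qed
    ultimately have "ennreal (R * \<delta> powr s / \<Psi> \<delta>)
        \<le> ennreal (\<alpha> j * ((3 / 4) ^ Suc M) ^ DIM('a \<times> 'b) * ((1/2) ^ Suc j) powr (real ?d / p))"
      by (simp only: ennreal_leI)
    also have "\<dots> \<le> Lp_norm (ennreal p) (fin_diff M ((1/2) ^ j *\<^sub>R e) (\<lambda>x. series (x, y)))"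
      by (rule Lp_norm_fin_diff_slice_ge [OF series e_in \<open>1 \<le> M\<close> p(1)]) (simp add: r_def, rule near)
    finally have "ennreal (R * \<delta> powr s / \<Psi> \<delta>) \<le> Lp_norm (ennreal p) (fin_diff M ((1/2) ^ j *\<^sub>R e) (\<lambda>x. series (x, y)))" .
    then show "\<exists>j\<ge>2. \<exists>h. norm h \<le> (1/2) ^ j \<and>
       ennreal (R * ((1/2) ^ j) powr s / \<Psi> ((1/2) ^ j)) \<le> Lp_norm (ennreal p) (fin_diff M h (\<lambda>x. series (x, y)))"
      using j(1) e_in by (intro exI [of _ j] conjI exI [of _ "(1/2) ^ j *\<^sub>R e"]) (auto simp: \<delta>_def)
  qed
  with in_space show ?thesis by blast
qed

theorem theorem1p7:
  fixes N d M :: nat and p s :: real and q :: ennreal and \<Psi> :: "real \<Rightarrow> real"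
  assumes "2 \<le> N" "1 \<le> d" "d < N"
    and "CARD('d::finite) = d" "CARD('m::finite) = N - d"
    and "0 < p" "ennreal p < q"
    and "sigma_p N p < s"
    and "s < real M"
    and "admissible \<Psi>"
    and "(\<Sum>j. ennreal (\<Psi> ((1/2) ^ j) powr chi p q)) = \<infinity>"
    and "q < \<infinity> \<Longrightarrow> mono_on {0<..1} \<Psi> \<Longrightarrow>
           ereal (enn2real q * p / (enn2real q - p)) < 1 / c_inf \<Psi>"
  shows "\<exists>f \<in> (besov_space M s (ennreal p) q :: ((real^'d) \<times> (real^'m) \<Rightarrow> real) set).
           AE y in lebesgue. (\<lambda>x. f (x, y)) \<notin> gen_besov_space M s \<Psi> (ennreal p) q"
proof -
  have "0 \<le> sigma_p N p" by (simp add: sigma_p_def)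
  then have "0 < s" using assms(8) by linarith
  then obtain f where "f \<in> (besov_space M s (ennreal p) q :: ((real^'d) \<times> (real^'m) \<Rightarrow> real) set)"
    "\<forall>y. (\<lambda>x. f (x, y)) \<notin> gen_besov_space M s \<Psi> (ennreal p) q"
    using exists_besov_function_with_rough_slices [where 'a = "real^'d" and 'b = "real^'m", of p q s M \<Psi>] assms(6,7,9-11) by blast
  then show ?thesis by (intro bexI [of _ f] AE_I2) auto
qed

end
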